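(* Consider the randomly switched system $\dot x = f_\sigma(x)$, $(x(0),\sigma(0))=(x_0,\sigma_0)$, $t\ge 0$. Suppose that: (E1) there exist continuously differentiable functions $V_i:\mathbb{R}^n\to\mathbb{R}$, $i\in\mathcal P$, functions $\alpha_1,\alpha_2\in\mathcal K_\infty$, and numbers $\mu>1$ and $\lambda_i\in\mathbb{R}$, $i\in\mathcal P$, such that for all $x\in\mathbb{R}^n$ and $i,j\in\mathcal P$: $\alpha_1(\|x\|)\le V_i(x)\le\alpha_2(\|x\|)$; $\langle\nabla V_i(x), f_i(x)\rangle\le -\lambda_i V_i(x)$; $V_i(x)\le\mu V_j(x)$; (E2) the switching signal $\sigma$ belongs to class EH with parameters $\lambda>0$ and $q_i\in[0,1]$, $i\in\mathcal P$; (E3) $\lambda_i+\lambda>0$ for all $i\in\mathcal P$; (E4) $\displaystyle\sum_{i\in\mathcal P}\frac{\mu q_i}{1+\lambda_i/\lambda}<1$. Then the system is $\alpha_1$-globally asymptotically stable in the mean.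
   Context: Notation: $\mathbb{N}=\{1,2,\dots\}$, $\mathbb{N}_0=\mathbb{N}\cup\{0\}$, $\|\cdot\|$ is the Euclidean norm, $\mathsf E$ is expectation. A function $\alpha:[0,\infty[\to[0,\infty[$ is of class $\mathcal K$ if it is continuous, strictly increasing and $\alpha(0)=0$; it is of class $\mathcal K_\infty$ if in addition it is unbounded. Setting: $\mathcal P=\{1,\dots,\mathrm N\}$ is a finite index set; for each $i\in\mathcal P$ the vector field $f_i:\mathbb{R}^n\to\mathbb{R}^n$ is locally Lipschitz with $f_i(0)=0$. On a complete probability space $(\Omega,\mathfrak F,\mathsf P)$, the switching signal $\sigma=(\sigma(t))_{t\ge0}$ is a càdlàg $\mathcal P$-valued process with $\sigma(0)=\sigma_0$ deterministic. Its switching instants are $0=\tau_0<\tau_1<\tau_2<\cdots$ (almost surely); $\sigma$ is constant on each $[\tau_i,\tau_{i+1}[$, and $\sigma(\tau_i)=\sigma(\tau_{i-1})$ is allowed. The holding times are $S_i:=\tau_i-\tau_{i-1}$, $i\in\mathbb{N}$. The state $x$ does not jump at switching instants, and $x(\cdot)$ denotes the (pathwise, Carathéodory, absolutely continuous) solution of the switched system for the initial state $x_0$. Class EH: $\sigma$ belongs to class EH if (EH1) $(S_i)_{i\in\mathbb{N}}$ is i.i.d., each $S_i$ exponential with parameter $\lambda>0$, i.e. $\mathsf P(S_i\le s)=1-e^{-\lambda s}$ for $s\ge0$; (EH2) there exist $q_i\in[0,1]$, $i\in\mathcal P$, such that for all $j\in\mathbb{N}$, $\mathsf P\big(\sigma(\tau_j)=i\,\big|\,(\sigma(\tau_k))_{k=0}^{j-1}\big)=q_i$;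 (EH3) the sequences $(S_i)_{i\in\mathbb{N}}$ and $(\sigma(\tau_i))_{i\in\mathbb{N}_0}$ are mutually independent. For $\alpha\in\mathcal K$, $\alpha$-global asymptotic stability in the mean means: (SM1) for every $\varepsilon>0$ there is $\widetilde\delta>0$ such that for every $x_0$, $\|x_0\|<\widetilde\delta$ implies $\sup_{t\ge0}\mathsf E[\alpha(\|x(t)\|)]<\varepsilon$; and (SM2) for all $r,\varepsilon'>0$ there is $\widetilde T\ge0$ such that for every $x_0$, $\|x_0\|<r$ implies $\sup_{t\ge\widetilde T}\mathsf E[\alpha(\|x(t)\|)]<\varepsilon'$. *)

theory Defs
  imports "HOL-Probability.Probability"
begin

text \<open>Comparison functions live on \<open>[0,\<infinity>)\<close>; their values at negative arguments are irrelevant.\<close>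

definition class_K :: "(real \<Rightarrow> real) \<Rightarrow> bool" where
  "class_K \<alpha> \<longleftrightarrow> continuous_on {0..} \<alpha> \<and> strict_mono_on {0..} \<alpha> \<and> \<alpha> 0 = 0"

definition class_K_inf :: "(real \<Rightarrow> real) \<Rightarrow> bool" where
  "class_K_inf \<alpha> \<longleftrightarrow> class_K \<alpha> \<and> \<not> bounded (\<alpha> ` {0..})"

definition abs_continuous_between :: "real \<Rightarrow> real \<Rightarrow> (real \<Rightarrow> 'a::real_normed_vector) \<Rightarrow> bool" where
  "abs_continuous_between a b \<phi> \<longleftrightarrow>
     (\<forall>\<epsilon>>0. \<exists>\<delta>>0. \<forall>D. finite D \<and> (\<forall>(u, v)\<in>D. a \<le> u \<and> u \<le> v \<and> v \<le> b) \<and>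
        disjoint_family_on (\<lambda>(u, v). {u<..<v}) D \<and> (\<Sum>(u, v)\<in>D. v - u) < \<delta>
        \<longrightarrow> (\<Sum>(u, v)\<in>D. norm (\<phi> v - \<phi> u)) < \<epsilon>)"

definition cadlag :: "(real \<Rightarrow> 'a::t2_space) \<Rightarrow> bool" where
  "cadlag \<phi> \<longleftrightarrow> (\<forall>t\<ge>0. (\<phi> \<longlongrightarrow> \<phi> t) (at_right t)) \<and> (\<forall>t>0. \<exists>l. (\<phi> \<longlongrightarrow> l) (at_left t))"

text \<open>
  The index set is \<open>{1..N}\<close>; the type \<open>nat\<close> carries the discrete topology, so \<open>cadlag\<close> paths are
  right-continuous step functions. A switching instant \<open>\<tau> i\<close> need not be a jump: \<open>\<sigma>\<close> may take
  the same value at \<open>\<tau> i\<close> and \<open>\<tau> (Suc i)\<close>.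
\<close>

definition switching_signal ::
  "'w measure \<Rightarrow> nat \<Rightarrow> nat \<Rightarrow> (real \<Rightarrow> 'w \<Rightarrow> nat) \<Rightarrow> (nat \<Rightarrow> 'w \<Rightarrow> real) \<Rightarrow> bool" where
  "switching_signal M N \<sigma>0 \<sigma> \<tau> \<longleftrightarrow>
     (\<forall>t\<ge>0. \<sigma> t \<in> measurable M (count_space {1..N})) \<and>
     (\<forall>\<omega>\<in>space M. cadlag (\<lambda>t. \<sigma> t \<omega>)) \<and>
     (\<forall>\<omega>\<in>space M. \<sigma> 0 \<omega> = \<sigma>0) \<and>
     (\<forall>i. \<tau> i \<in> borel_measurable M) \<and>
     (AE \<omega> in M. \<tau> 0 \<omega> = 0 \<and> (\<forall>i. \<tau> i \<omega> < \<tau> (Suc i) \<omega>) \<and>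
        (\<forall>i. \<forall>t. \<tau> i \<omega> \<le> t \<and> t < \<tau> (Suc i) \<omega> \<longrightarrow> \<sigma> t \<omega> = \<sigma> (\<tau> i \<omega>) \<omega>))"

definition holding_time :: "(nat \<Rightarrow> 'w \<Rightarrow> real) \<Rightarrow> nat \<Rightarrow> 'w \<Rightarrow> real" where
  "holding_time \<tau> i \<omega> = \<tau> i \<omega> - \<tau> (i - 1) \<omega>"

definition mode_at :: "(real \<Rightarrow> 'w \<Rightarrow> nat) \<Rightarrow> (nat \<Rightarrow> 'w \<Rightarrow> real) \<Rightarrow> nat \<Rightarrow> 'w \<Rightarrow> nat" where
  "mode_at \<sigma> \<tau> j \<omega> = \<sigma> (\<tau> j \<omega>) \<omega>"

text \<open>The \<open>\<sigma>\<close>-algebra on \<open>space M\<close> generated by the family \<open>(X i)\<close>, \<open>i \<in> I\<close>, of \<open>B\<close>-valued maps.\<close>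

definition family_algebra :: "'w measure \<Rightarrow> 'b measure \<Rightarrow> 'i set \<Rightarrow> ('i \<Rightarrow> 'w \<Rightarrow> 'b) \<Rightarrow> 'w measure" where
  "family_algebra M B I X = vimage_algebra (space M) (\<lambda>\<omega>. \<lambda>i\<in>I. X i \<omega>) (\<Pi>\<^sub>M i\<in>I. B)"

text \<open>
  Independence of the holding times and the modes is stated for the generated \<open>\<sigma>\<close>-algebras, since
  \<open>prob_space.indep_var\<close> only relates random variables of the same type.
\<close>

definition class_EH ::
  "'w measure \<Rightarrow> nat \<Rightarrow> (real \<Rightarrow> 'w \<Rightarrow> nat) \<Rightarrow> (nat \<Rightarrow> 'w \<Rightarrow> real) \<Rightarrow> real \<Rightarrow> (nat \<Rightarrow> real) \<Rightarrow> bool" where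
  "class_EH M N \<sigma> \<tau> lam q \<longleftrightarrow>
     lam > 0 \<and>
     prob_space.indep_vars M (\<lambda>_. borel) (holding_time \<tau>) {1..} \<and>
     (\<forall>i\<ge>1. \<forall>s\<ge>0. measure M {\<omega>\<in>space M. holding_time \<tau> i \<omega> \<le> s} = 1 - exp (- lam * s)) \<and>
     (\<forall>i\<in>{1..N}. q i \<in> {0..1}) \<and>
     (\<forall>j\<ge>1. \<forall>i\<in>{1..N}. AE \<omega> in M.
        real_cond_exp M (family_algebra M (count_space UNIV) {..<j} (mode_at \<sigma> \<tau>))
          (indicator {\<omega>\<in>space M. mode_at \<sigma> \<tau> j \<omega> = i}) \<omega> = q i) \<and>
     prob_space.indep_set M
       (sets (family_algebra M borel {1..} (holding_time \<tau>)))
       (sets (family_algebra M (count_space UNIV) UNIV (mode_at \<sigma> \<tau>)))"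

text \<open>
  A state process: each \<open>x t\<close> is a random vector, and almost every path is a Caratheodory solution
  on \<open>[0,\<infinity>)\<close>.
\<close>

definition switched_solution ::
  "'w measure \<Rightarrow> (nat \<Rightarrow> 'a::euclidean_space \<Rightarrow> 'a) \<Rightarrow> (real \<Rightarrow> 'w \<Rightarrow> nat) \<Rightarrow> 'a \<Rightarrow> (real \<Rightarrow> 'w \<Rightarrow> 'a) \<Rightarrow> bool" where
  "switched_solution M f \<sigma> x0 x \<longleftrightarrow>
     (\<forall>t\<ge>0. x t \<in> borel_measurable M) \<and>
     (AE \<omega> in M. x 0 \<omega> = x0 \<and>
        (\<forall>T\<ge>0. abs_continuous_between 0 T (\<lambda>t. x t \<omega>)) \<and>
        (AE t in lborel. 0 \<le> t \<longrightarrow>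
           ((\<lambda>s. x s \<omega>) has_vector_derivative f (\<sigma> t \<omega>) (x t \<omega>)) (at t within {0..})))"

text \<open>
  Expectations of nonnegative quantities are \<open>ennreal\<close>-valued integrals, so that \<open>< ennreal \<epsilon>\<close>
  includes finiteness; the bounds are uniform over all solutions started in the given ball.
\<close>

definition gas_in_mean ::
  "'w measure \<Rightarrow> (nat \<Rightarrow> 'a::euclidean_space \<Rightarrow> 'a) \<Rightarrow> (real \<Rightarrow> 'w \<Rightarrow> nat) \<Rightarrow> (real \<Rightarrow> real) \<Rightarrow> bool" where
  "gas_in_mean M f \<sigma> \<alpha> \<longleftrightarrow>
     (\<forall>\<epsilon>>0. \<exists>\<delta>>0. \<forall>x0 x. switched_solution M f \<sigma> x0 x \<and> norm x0 < \<delta> \<longrightarrow>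
        (SUP t\<in>{0..}. \<integral>\<^sup>+\<omega>. ennreal (\<alpha> (norm (x t \<omega>))) \<partial>M) < ennreal \<epsilon>) \<and>
     (\<forall>r>0. \<forall>\<epsilon>>0. \<exists>T\<ge>0. \<forall>x0 x. switched_solution M f \<sigma> x0 x \<and> norm x0 < r \<longrightarrow>
        (SUP t\<in>{T..}. \<integral>\<^sup>+\<omega>. ennreal (\<alpha> (norm (x t \<omega>))) \<partial>M) < ennreal \<epsilon>)"

end

theory Submission
  imports Defs
begin

text \<open>
  Along a path, put \<open>Z k = (\<Prod>j<k. \<mu> * exp (- (lami (\<sigma> (\<tau> j)) - c) * S (j + 1)))\<close>.
  Between \<open>\<tau> k\<close> and \<open>\<tau> (k + 1)\<close> the Lyapunov estimates give
  \<open>exp (c * t) * V (\<sigma> t) (x t) \<le> V \<sigma>0 x0 * (Z k + Z (k + 1))\<close>, because \<open>exp (- a * u) \<le> 1 + exp (- a * S)\<close>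
  for \<open>0 \<le> u \<le> S\<close> whatever the sign of \<open>a\<close>. This removes the dependence on the random index of the
  current holding interval: it suffices to bound the expectation of \<open>\<Sum>k. Z k\<close>. By independence that
  expectation is a geometric series of ratio \<open>\<rho> c = (\<Sum>i. \<mu> * q i * lam / (lam + lami i - c))\<close>, and (E4)
  says \<open>\<rho> 0 < 1\<close>, so \<open>\<rho> c < 1\<close> for some \<open>c > 0\<close>. Hence the mean of \<open>V\<close> decays like \<open>exp (- c * t)\<close>.
\<close>

subsection \<open>Absolutely continuous trajectories\<close>

lemma abs_continuous_between_subinterval:
  assumes "abs_continuous_between a b g" "a \<le> c" "d \<le> b"
  shows "abs_continuous_between c d g"
  unfolding abs_continuous_between_def
proof (intro allI impI)
  fix e :: real assume "e > 0"
  then obtain \<delta> where "\<delta> > 0" and \<delta>: "\<And>D. finite D \<Longrightarrow> \<forall>(u, v)\<in>D. a \<le> u \<and> u \<le> v \<and> v \<le> b \<Longrightarrow>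
      disjoint_family_on (\<lambda>(u, v). {u<..<v}) D \<Longrightarrow> (\<Sum>(u, v)\<in>D. v - u) < \<delta>
        \<Longrightarrow> (\<Sum>(u, v)\<in>D. norm (g v - g u)) < e"
    using assms(1) unfolding abs_continuous_between_def by meson
  have "(\<Sum>(u, v)\<in>D. norm (g v - g u)) < e"
    if "finite D" "\<forall>(u, v)\<in>D. c \<le> u \<and> u \<le> v \<and> v \<le> d"
      "disjoint_family_on (\<lambda>(u, v). {u<..<v}) D" "(\<Sum>(u, v)\<in>D. v - u) < \<delta>" for D
  proof (rule \<delta>)
    show "\<forall>(u, v)\<in>D. a \<le> u \<and> u \<le> v \<and> v \<le> b"
      using that(2) assms(2,3) by fastforce
  qed (use that in auto)
  then show "\<exists>\<delta>>0. \<forall>D. finite D \<and> (\<forall>(u, v)\<in>D. c \<le> u \<and> u \<le> v \<and> v \<le> d) \<and>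
        disjoint_family_on (\<lambda>(u, v). {u<..<v}) D \<and> (\<Sum>(u, v)\<in>D. v - u) < \<delta>
        \<longrightarrow> (\<Sum>(u, v)\<in>D. norm (g v - g u)) < e"
    using \<open>\<delta> > 0\<close> by blast
qed

text \<open>A family consisting of one interval suffices. Both orders of the endpoints are tried
  because the families only contain pairs \<open>(u, v)\<close> with
  \<open>u \<le> v\<close>.\<close>

lemma abs_continuous_between_imp_continuous_on:
  assumes "abs_continuous_between a b g"
  shows "continuous_on {a..b} g"
  unfolding continuous_on_iff
proof (intro ballI allI impI)
  fix x e :: real assume x: "x \<in> {a..b}" and "e > 0"
  then obtain \<delta> where "\<delta> > 0" and \<delta>: "\<And>D. finite D \<Longrightarrow> \<forall>(u, v)\<in>D. a \<le> u \<and> u \<le> v \<and> v \<le> b \<Longrightarrow>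
      disjoint_family_on (\<lambda>(u, v). {u<..<v}) D \<Longrightarrow> (\<Sum>(u, v)\<in>D. v - u) < \<delta>
        \<Longrightarrow> (\<Sum>(u, v)\<in>D. norm (g v - g u)) < e"
    using assms unfolding abs_continuous_between_def by meson
  have "dist (g y) (g x) < e" if "y \<in> {a..b}" "dist y x < \<delta>" for y
    using \<delta>[of "{(x, y)}"] \<delta>[of "{(y, x)}"] x that
    by (cases "x \<le> y") (auto simp: disjoint_family_on_def dist_norm norm_minus_commute)
  then show "\<exists>d>0. \<forall>x'\<in>{a..b}. dist x' x < d \<longrightarrow> dist (g x') (g x) < e"
    using \<open>\<delta> > 0\<close> by blast
qed

text \<open>
  The gauge forces the intervals tagged in the null set \<open>E\<close> into an open set of small measure, where
  absolute continuity controls the increments of \<open>g\<close>; the other intervals obey the straddle estimate.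
\<close>

lemma fundamental_theorem_of_calculus_abs_continuous:
  fixes g :: "real \<Rightarrow> 'a::real_normed_vector"
  assumes "a \<le> b" and ac: "abs_continuous_between a b g" and E: "negligible E"
    and deriv: "\<And>t. t \<in> {a..b} - E \<Longrightarrow> (g has_vector_derivative g' t) (at t within {a..b})"
  shows "(g' has_integral g b - g a) {a..b}"
proof (rule has_integral_spike[OF E])
  \<comment> \<open>On \<open>E\<close> the values of \<open>g'\<close> are arbitrary. Replacing
    them by zero does not change the integral, and the Riemann terms tagged in \<open>E\<close> then
    vanish, leaving only increments of \<open>g\<close>.\<close>
  define h where "h t = (if t \<in> E then 0 else g' t)" for t
  show "g' x = h x" if "x \<in> {a..b} - E" for x
    using that by (simp add: h_def)
  show "(h has_integral g b - g a) {a..b}"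
    unfolding has_integral_real
  proof (intro allI impI)
    fix e :: real assume "e > 0"
    \<comment> \<open>The summand \<open>1\<close> keeps the denominator positive when
      \<open>a = b\<close>. The straddle errors add up to at most \<open>e' * (b - a)\<close>, which
      is below \<open>e / 2\<close>.\<close>
    define e' where "e' = e / (2 * (b - a + 1))"
    have "e' > 0" using \<open>e > 0\<close> \<open>a \<le> b\<close> by (simp add: e'_def)
    have e'_less: "e' * (b - a) < e / 2"
      using \<open>e > 0\<close> \<open>a \<le> b\<close> by (simp add: e'_def field_simps)
    obtain \<delta> where "\<delta> > 0" and \<delta>: "\<And>D. finite D \<Longrightarrow> \<forall>(u, v)\<in>D. a \<le> u \<and> u \<le> v \<and> v \<le> b \<Longrightarrow>
        disjoint_family_on (\<lambda>(u, v). {u<..<v}) D \<Longrightarrow> (\<Sum>(u, v)\<in>D. v - u) < \<delta>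
          \<Longrightarrow> (\<Sum>(u, v)\<in>D. norm (g v - g u)) < e / 2"
      using ac[unfolded abs_continuous_between_def, rule_format, OF half_gt_zero[OF \<open>e > 0\<close>]] by blast
    have E': "E \<in> sets lebesgue" "emeasure lebesgue E = 0"
      using E by (auto simp: negligible_iff_null_sets null_sets_def)
    obtain U where U: "open U" "E \<subseteq> U" "U - E \<in> lmeasurable" "emeasure lebesgue (U - E) < ennreal \<delta>"
      using sets_lebesgue_outer_open[OF E'(1) \<open>\<delta> > 0\<close>] by metis
    have "emeasure lebesgue U \<le> emeasure lebesgue (U - E) + emeasure lebesgue E"
      using U E' by (metis Diff_partition Un_Diff_cancel2 Un_commute emeasure_subadditive fmeasurableD order_refl)
    then have mU: "emeasure lborel U < ennreal \<delta>"
      using U E' by (simp add: borel_open le_less_trans)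
    \<comment> \<open>The guard makes the estimate vacuous at the other points, where the radius
      defaults to \<open>1\<close>. So \<open>d\<close> is positive on the whole line, as a gauge
      demands.\<close>
    have "\<exists>d>0. t \<in> {a..b} - E \<longrightarrow>
         (\<forall>y\<in>{a..b}. norm (y-t) < d \<longrightarrow> norm (g y - g t - (y-t) *\<^sub>R g' t) \<le> e' * norm (y-t))" for t
    proof (cases "t \<in> {a..b} - E")
      case True
      from deriv[OF this, unfolded has_vector_derivative_def has_derivative_within_alt] \<open>e' > 0\<close>
      show ?thesis by metis
    qed (auto intro: exI[of _ 1])
    then obtain d where d: "\<And>t. 0 < d t"
      "\<And>t y. t \<in> {a..b} - E \<Longrightarrow> y \<in> {a..b} \<Longrightarrow> norm (y-t) < d t \<Longrightarrow>
          norm (g y - g t - (y-t) *\<^sub>R g' t) \<le> e' * norm (y-t)"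
      by metis
    define \<gamma> where "\<gamma> t = (if t \<in> E then U else ball t (d t))" for t
    have gauge: "gauge \<gamma>"
      using U d(1) by (auto simp: gauge_def \<gamma>_def)
    have bound: "norm ((\<Sum>(x, K)\<in>p. measure lborel K *\<^sub>R h x) - (g b - g a)) < e"
      if p: "p tagged_division_of {a..b}" and fine: "\<gamma> fine p" for p
    proof -
      note pD = tagged_division_ofD[OF p]
      have K: "\<exists>u v. K = {u..v} \<and> u \<le> x \<and> x \<le> v \<and> a \<le> u \<and> v \<le> b \<and> Inf K = u \<and> Sup K = v \<and> measure lborel K = v - u"
        if xK: "(x, K) \<in> p" for x K
      proof -
        obtain u v where "K = {u..v}" using pD(4)[OF xK] by auto
        with pD(2,3)[OF xK] show ?thesis by (intro exI[of _ u] exI[of _ v]) auto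
      qed
      \<comment> \<open>Degenerate intervals are left out: two of them may coincide, which would break injectivity of \<open>I\<close>.\<close>
      define p1 where "p1 = {(x, K)\<in>p. x \<in> E \<and> Inf K < Sup K}"
      have p1: "finite p1" "p1 \<subseteq> p" using pD(1) by (auto simp: p1_def intro: finite_subset[of _ p])
      define I where "I = (\<lambda>(x::real, K::real set). (Inf K, Sup K))"
      have disj: "{Inf K<..<Sup K} \<inter> {Inf L<..<Sup L} = {}"
        if xK: "(x, K) \<in> p" and yL: "(y, L) \<in> p" and neq: "(x, K) \<noteq> (y, L)" for x K y L
      proof -
        obtain u v u' v' where "K = {u..v}" "L = {u'..v'}" "Inf K = u" "Sup K = v" "Inf L = u'" "Sup L = v'"
          using K[OF xK] K[OF yL] by metis
        then show ?thesis using pD(5)[OF xK yL neq] by simp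
      qed
      have inj: "inj_on I p1"
      proof (rule inj_onI, clarify)
        fix x K y L assume *: "(x, K) \<in> p1" "(y, L) \<in> p1" "I (x, K) = I (y, L)"
        show "x = y \<and> K = L"
        proof (rule ccontr)
          assume "\<not> ?thesis"
          then have "{Inf K<..<Sup K} \<inter> {Inf L<..<Sup L} = {}"
            using disj[of x K y L] * p1(2) by auto
          then show False using * by (auto simp: I_def p1_def)
        qed
      qed
      have disjoint: "disjoint_family_on (\<lambda>(u, v). {u<..<v}) (I ` p1)"
        using disj p1(2) by (fastforce simp: disjoint_family_on_def I_def)
      have bounds: "\<forall>(u, v)\<in>I ` p1. a \<le> u \<and> u \<le> v \<and> v \<le> b"
        using K p1(2) by (fastforce simp: I_def)
      have "(\<Sum>(u, v)\<in>I ` p1. ennreal (v - u)) = (\<Sum>w\<in>I ` p1. emeasure lborel ((\<lambda>(u, v). {u<..<v}) w))"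
        using bounds by (intro sum.cong) auto
      also have "\<dots> = emeasure lborel (\<Union>w\<in>I ` p1. (\<lambda>(u, v). {u<..<v}) w)"
        by (rule sum_emeasure) (use p1 disjoint in auto)
      also have "\<dots> \<le> emeasure lborel U"
      proof (rule emeasure_mono)
        show "(\<Union>w\<in>I ` p1. (\<lambda>(u, v). {u<..<v}) w) \<subseteq> U"
        proof (rule UN_least)
          fix w assume "w \<in> I ` p1"
          then obtain x K where w: "w = (Inf K, Sup K)" and "(x, K) \<in> p" "x \<in> E"
            by (auto simp: p1_def I_def)
          obtain u v where "K = {u..v}" "Inf K = u" "Sup K = v"
            using K[OF \<open>(x, K) \<in> p\<close>] by metis
          moreover have "K \<subseteq> U"
            using fineD[OF fine \<open>(x, K) \<in> p\<close>] \<open>x \<in> E\<close> by (simp add: \<gamma>_def)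
          ultimately show "(\<lambda>(u, v). {u<..<v}) w \<subseteq> U"
            unfolding w by auto
        qed
      qed (use U in auto)
      finally have "(\<Sum>(u, v)\<in>I ` p1. ennreal (v - u)) < ennreal \<delta>"
        using mU by simp
      moreover have "(\<Sum>(u, v)\<in>I ` p1. ennreal (v - u)) = ennreal (\<Sum>(u, v)\<in>I ` p1. v - u)"
        using bounds by (subst sum_ennreal[symmetric]) (auto simp: case_prod_beta)
      ultimately have "(\<Sum>(u, v)\<in>I ` p1. v - u) < \<delta>"
        by (metis ennreal_leI linorder_not_le)
      then have "(\<Sum>(u, v)\<in>I ` p1. norm (g v - g u)) < e / 2"
        using p1 bounds disjoint by (intro \<delta>) auto
      also have "(\<Sum>(u, v)\<in>I ` p1. norm (g v - g u)) = (\<Sum>(x, K)\<in>p1. norm (g (Sup K) - g (Inf K)))"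
        by (subst sum.reindex[OF inj]) (auto simp: I_def case_prod_beta)
      finally have sum1: "(\<Sum>(x, K)\<in>p1. norm (g (Sup K) - g (Inf K))) < e / 2" .
      \<comment> \<open>Each term compares a Riemann contribution with an increment of
        \<open>g\<close>; over a tagged division the increments telescope to
        \<open>g b - g a\<close>.\<close>
      let ?T = "\<lambda>(x, K). measure lborel K *\<^sub>R h x - (g (Sup K) - g (Inf K))"
      have "norm ((\<Sum>(x, K)\<in>p. measure lborel K *\<^sub>R h x) - (g b - g a)) = norm (\<Sum>w\<in>p. ?T w)"
        using additive_tagged_division_1[OF \<open>a \<le> b\<close> p, of g]
        by (simp add: sum_subtractf case_prod_beta)
      also have "\<dots> \<le> norm (\<Sum>w\<in>p1. ?T w) + norm (\<Sum>w\<in>p - p1. ?T w)"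
        using sum.subset_diff[OF p1(2) pD(1), of ?T] norm_triangle_ineq[of "\<Sum>w\<in>p1. ?T w" "\<Sum>w\<in>p - p1. ?T w"]
        by (simp add: add.commute)
      also have "norm (\<Sum>w\<in>p1. ?T w) \<le> (\<Sum>(x, K)\<in>p1. norm (g (Sup K) - g (Inf K)))"
        by (rule sum_norm_le) (auto simp: p1_def h_def norm_minus_commute)
      also have "norm (\<Sum>w\<in>p - p1. ?T w) \<le> (\<Sum>(x, K)\<in>p - p1. e' * (Sup K - Inf K))"
      proof (rule sum_norm_le, clarify)
        fix x K assume w: "(x, K) \<in> p" "(x, K) \<notin> p1"
        obtain u v where K: "K = {u..v}" "u \<le> x" "x \<le> v" "a \<le> u" "v \<le> b" "Inf K = u" "Sup K = v"
            "measure lborel K = v - u"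
          using K[OF w(1)] by metis
        show "norm (measure lborel K *\<^sub>R h x - (g (Sup K) - g (Inf K))) \<le> e' * (Sup K - Inf K)"
        proof (cases "x \<in> E")
          case True
          \<comment> \<open>A tag in \<open>E\<close> outside \<open>p1\<close> means that the
            interval is degenerate, so both sides of the estimate are zero.\<close>
          then have "u = v" using w K by (auto simp: p1_def)
          then show ?thesis using K by simp
        next
          case False
          have "K \<subseteq> ball x (d x)" using fineD[OF fine w(1)] False by (simp add: \<gamma>_def)
          then have uv: "u \<in> ball x (d x)" "v \<in> ball x (d x)" using K(1-3) by (auto simp del: mem_ball)
          have "norm ((v - u) *\<^sub>R g' x - (g v - g u))
              = norm (g u - g x - (u - x) *\<^sub>R g' x - (g v - g x - (v - x) *\<^sub>R g' x))"
            by (auto simp: algebra_simps)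
          also have "\<dots> \<le> norm (g u - g x - (u - x) *\<^sub>R g' x) + norm (g v - g x - (v - x) *\<^sub>R g' x)"
            by (rule norm_triangle_ineq4)
          also have "\<dots> \<le> e' * norm (u - x) + e' * norm (v - x)"
            using uv K False by (intro add_mono d(2)) (auto simp: dist_norm norm_minus_commute)
          also have "\<dots> = e' * (v - u)"
            using K by (simp add: algebra_simps)
          finally show ?thesis using K False by (simp add: h_def)
        qed
      qed
      also have "\<dots> \<le> (\<Sum>(x, K)\<in>p. e' * (Sup K - Inf K))"
      proof (rule sum_mono2[OF pD(1)])
        fix w assume "w \<in> p - (p - p1)"
        then obtain x K where w: "w = (x, K)" "(x, K) \<in> p" by (cases w) auto
        from K[OF w(2)] show "0 \<le> (case w of (x, K) \<Rightarrow> e' * (Sup K - Inf K))"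
          using \<open>e' > 0\<close> w(1) by fastforce
      qed auto
      also have "\<dots> = e' * (b - a)"
        using additive_tagged_division_1[OF \<open>a \<le> b\<close> p, of "\<lambda>x. x"]
        by (simp add: sum_distrib_left[symmetric] case_prod_beta)
      finally show ?thesis using sum1 e'_less by linarith
    qed
    show "\<exists>\<gamma>. gauge \<gamma> \<and> (\<forall>p. p tagged_division_of {a..b} \<and> \<gamma> fine p \<longrightarrow>
        norm ((\<Sum>(x, K)\<in>p. measure lborel K *\<^sub>R h x) - (g b - g a)) < e)"
      by (intro exI[of _ \<gamma>] conjI allI impI gauge bound) auto
  qed
qed

text \<open>Within one mode, \<open>V (y t) * exp (l * (t - a))\<close> has nonpositive derivative.
  To differentiate it at every interior point, and not merely almost everywhere, the solution is
  first rewritten through its integral equation.\<close>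

lemma lyapunov_exponential_bound:
  fixes y :: "real \<Rightarrow> 'a::euclidean_space" and V :: "'a \<Rightarrow> real"
  assumes "a \<le> b" and ac: "abs_continuous_between a b y" and E: "negligible E"
    and ode: "\<And>t. t \<in> {a..b} - E \<Longrightarrow> (y has_vector_derivative f (y t)) (at t within {a..b})"
    and f: "continuous_on UNIV f"
    and V: "\<And>z. GDERIV V z :> V' z"
    and decay: "\<And>z. V' z \<bullet> f z \<le> - l * V z"
  shows "V (y b) \<le> V (y a) * exp (- l * (b - a))"
proof -
  have cont: "continuous_on {a..b} y"
    by (rule abs_continuous_between_imp_continuous_on[OF ac])
  have cf: "continuous_on {a..b} (\<lambda>t. f (y t))"
    by (rule continuous_on_compose2[OF f cont]) auto
  have int: "y t = y a + integral {a..t} (\<lambda>t. f (y t))" if "t \<in> {a..b}" for t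
  proof -
    have "((\<lambda>t. f (y t)) has_integral y t - y a) {a..t}"
      by (rule fundamental_theorem_of_calculus_abs_continuous[OF _ abs_continuous_between_subinterval[OF ac] E])
        (use that in \<open>auto intro!: has_vector_derivative_within_subset[OF ode]\<close>)
    then show ?thesis by (simp add: integral_unique)
  qed
  \<comment> \<open>The integrand \<open>f (y t)\<close> is continuous, so the integral equation
    yields the derivative at every interior point. The exceptional set disappears and the classical
    monotonicity criterion applies.\<close>
  have y': "(y has_vector_derivative f (y t)) (at t)" if "a < t" "t < b" for t
  proof -
    have "((\<lambda>t. y a + integral {a..t} (\<lambda>t. f (y t))) has_vector_derivative f (y t)) (at t within {a..b})"
      using integral_has_vector_derivative[OF cf, of t] that by (auto intro!: derivative_eq_intros)
    then have "(y has_vector_derivative f (y t)) (at t within {a..b})"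
      using has_vector_derivative_transform[OF _ int] that by fastforce
    then show ?thesis using that by (simp add: at_within_Icc_at)
  qed
  have cV: "continuous_on UNIV V"
    using V unfolding gderiv_def
    by (meson continuous_at_imp_continuous_on has_derivative_continuous)
  let ?\<phi> = "\<lambda>t. V (y t) * exp (l * (t - a))"
  have "?\<phi> b \<le> ?\<phi> a"
  proof (rule DERIV_nonpos_imp_decreasing_open[OF \<open>a \<le> b\<close>])
    fix t assume t: "a < t" "t < b"
    have "((\<lambda>t. V (y t)) has_derivative (\<lambda>h. (h *\<^sub>R f (y t)) \<bullet> V' (y t))) (at t)"
      using has_derivative_compose[OF y'[OF t, unfolded has_vector_derivative_def] V[unfolded gderiv_def]] .
    then have "((\<lambda>t. V (y t)) has_real_derivative (V' (y t) \<bullet> f (y t))) (at t)"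
      by (simp add: has_field_derivative_def inner_commute mult_commute_abs)
    then have "(?\<phi> has_real_derivative (V' (y t) \<bullet> f (y t) + l * V (y t)) * exp (l * (t - a))) (at t)"
      by (auto intro!: derivative_eq_intros simp: algebra_simps)
    moreover have "(V' (y t) \<bullet> f (y t) + l * V (y t)) * exp (l * (t - a)) \<le> 0"
      using decay[of "y t"] by (simp add: mult_nonpos_nonneg)
    ultimately show "\<exists>d. (?\<phi> has_real_derivative d) (at t) \<and> d \<le> 0" by blast
  next
    show "continuous_on {a..b} ?\<phi>"
      by (intro continuous_intros continuous_on_compose2[OF cV cont]) auto
  qed
  then have "V (y b) * exp (l * (b - a)) * exp (- l * (b - a)) \<le> V (y a) * exp (- l * (b - a))"
    by (intro mult_right_mono) auto
  then show ?thesis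
    by (simp add: mult.assoc mult_exp_exp)
qed

subsection \<open>Signals of class EH\<close>

text \<open>Multiplying the exponential density of rate \<open>l\<close> by
  \<open>exp (- a * x)\<close> gives \<open>l / (l + a)\<close> times the density of rate
  \<open>l + a\<close>, whose mass is one. This is where positivity of \<open>l + a\<close>
  enters.\<close>

lemma (in prob_space) nn_integral_exp_exponential_distributed:
  assumes D: "distributed M lborel X (exponential_density l)" and l: "0 < l" "0 < l + a"
  shows "(\<integral>\<^sup>+\<omega>. ennreal (exp (- a * X \<omega>)) \<partial>M) = ennreal (l / (l + a))"
proof -
  have "(\<integral>\<^sup>+\<omega>. ennreal (exp (- a * X \<omega>)) \<partial>M)
      = (\<integral>\<^sup>+x. ennreal (exponential_density l x) * ennreal (exp (- a * x)) \<partial>lborel)"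
    by (rule distributed_nn_integral[OF D, symmetric]) measurable
  also have "\<dots> = (\<integral>\<^sup>+x. ennreal (l / (l + a)) * ennreal (exponential_density (l + a) x) \<partial>lborel)"
    using l by (intro nn_integral_cong)
      (auto simp: exponential_density_def ennreal_mult'[symmetric] mult_exp_exp distrib_left
        intro!: arg_cong[where f=ennreal] simp: mult.commute)
  also have "\<dots> = ennreal (l / (l + a)) * emeasure (density lborel (exponential_density (l + a))) UNIV"
    by (simp add: nn_integral_cmult emeasure_density)
  also have "\<dots> = ennreal (l / (l + a))"
    using prob_space.emeasure_space_1[OF prob_space_exponential_density[OF l(2)]] by simp
  finally show ?thesis .
qed

text \<open>\<open>Y\<close> and the indicator generate sub-algebras of the independent
  \<open>F\<close> and \<open>G\<close>, hence are independent variables. Both are taken with values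
  in \<open>ennreal\<close>, so that the product rule for nonnegative integrals applies without
  integrability conditions.\<close>

lemma (in prob_space) nn_integral_indicator_mult_indep:
  fixes Y :: "'a \<Rightarrow> ennreal"
  assumes indep: "indep_set (sets F) (sets G)" and space: "space F = space M" "space G = space M"
    and Y: "Y \<in> borel_measurable F" and A: "A \<in> sets G"
  shows "(\<integral>\<^sup>+\<omega>. indicator A \<omega> * Y \<omega> \<partial>M) = emeasure M A * (\<integral>\<^sup>+\<omega>. Y \<omega> \<partial>M)"
proof -
  have sub: "sets F \<subseteq> events" "sets G \<subseteq> events"
    using indep by (auto simp: indep_sets2_eq)
  have YM: "Y \<in> borel_measurable M"
    using Y sub(1) space(1) by (auto simp: measurable_def)
  have iG: "(indicator A :: 'a \<Rightarrow> ennreal) \<in> borel_measurable G"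
    using A by simp
  have le: "sigma_sets (space M) {X -` B \<inter> space M |B. B \<in> sets borel} \<subseteq> sets H"
    if "X \<in> borel_measurable H" "space H = space M" for X :: "'a \<Rightarrow> ennreal" and H
    unfolding that(2)[symmetric] by (rule sets.sigma_sets_subset) (use that(1) in auto)
  have "indep_var borel Y borel (indicator A :: 'a \<Rightarrow> ennreal)"
    unfolding indep_var_eq
  proof (intro conjI)
    show "indep_set (sigma_sets (space M) {Y -` B \<inter> space M |B. B \<in> sets borel})
        (sigma_sets (space M) {(indicator A :: 'a \<Rightarrow> ennreal) -` B \<inter> space M |B. B \<in> sets borel})"
      using indep le[OF Y space(1)] le[OF iG space(2)] unfolding indep_sets2_eq by blast
  qed (use YM A sub in auto)
  \<comment> \<open>The pair is viewed as a family indexed by booleans. Its target measure is a case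
    distinction with \<open>borel\<close> in both cases, which the congruence rule replaces by a
    constant.\<close>
  then have "indep_vars (\<lambda>_. borel) (case_bool Y (indicator A)) UNIV"
    unfolding indep_var_def by (rule iffD1[OF indep_vars_cong, rotated 3]) (auto split: bool.split)
  from indep_vars_nn_integral[OF _ this]
  have "(\<integral>\<^sup>+\<omega>. Y \<omega> * indicator A \<omega> \<partial>M) = (\<integral>\<^sup>+\<omega>. Y \<omega> \<partial>M) * (\<integral>\<^sup>+\<omega>. indicator A \<omega> \<partial>M)"
    by (simp add: UNIV_bool mult.commute)
  then show ?thesis
    using A sub by (simp add: mult.commute subset_iff)
qed

section \<open>Generated algebras and the measurability they supply\<close>

lemma space_family_algebra [simp]: "space (family_algebra M B I X) = space M"
  by (simp add: family_algebra_def)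

lemma measurable_family_algebra:
  assumes "i \<in> I" "\<And>i \<omega>. i \<in> I \<Longrightarrow> \<omega> \<in> space M \<Longrightarrow> X i \<omega> \<in> space B"
  shows "X i \<in> measurable (family_algebra M B I X) B"
proof -
  have "(\<lambda>\<omega>. \<lambda>i\<in>I. X i \<omega>) \<in> measurable (family_algebra M B I X) (\<Pi>\<^sub>M i\<in>I. B)"
    unfolding family_algebra_def
    by (rule measurable_vimage_algebra1) (use assms(2) in \<open>auto simp: space_PiM\<close>)
  from measurable_compose[OF this measurable_component_singleton[OF assms(1)]]
  show ?thesis using assms(1) by simp
qed

lemma sets_family_algebra_subset:
  assumes "\<And>i. i \<in> I \<Longrightarrow> X i \<in> measurable M B"
  shows "sets (family_algebra M B I X) \<subseteq> sets M"
  unfolding family_algebra_def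
  by (rule sets_image_in_sets) (use assms in \<open>auto intro: measurable_restrict\<close>)

text \<open>Independence of two collections of sets includes that their members are events.
  Measurability of the modes, which are values of the signal at random times, is read off from (EH3)
  in this way.\<close>

lemma (in prob_space) class_EH_measurable:
  assumes EH: "class_EH M N \<sigma> \<tau> lam q"
  shows "mode_at \<sigma> \<tau> j \<in> measurable M (count_space UNIV)"
    and "i \<ge> 1 \<Longrightarrow> holding_time \<tau> i \<in> borel_measurable M"
proof -
  have "sets (family_algebra M (count_space UNIV) UNIV (mode_at \<sigma> \<tau>)) \<subseteq> events"
    using EH by (auto simp: class_EH_def indep_sets2_eq)
  moreover have "mode_at \<sigma> \<tau> j \<in> measurable (family_algebra M (count_space UNIV) UNIV (mode_at \<sigma> \<tau>)) (count_space UNIV)"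
    by (rule measurable_family_algebra) auto
  ultimately show "mode_at \<sigma> \<tau> j \<in> measurable M (count_space UNIV)"
    unfolding measurable_def by (simp add: subset_iff)
  show "i \<ge> 1 \<Longrightarrow> holding_time \<tau> i \<in> borel_measurable M"
    using EH by (auto simp: class_EH_def indep_vars_def)
qed

lemma (in prob_space) class_EH_distributed:
  assumes EH: "class_EH M N \<sigma> \<tau> lam q" and "i \<ge> 1"
  shows "distributed M lborel (holding_time \<tau> i) (exponential_density lam)"
  using EH assms(2) class_EH_measurable(2)[OF EH assms(2)]
  by (subst exponential_distributed_iff) (auto simp: class_EH_def mult.commute)

lemma (in prob_space) class_EH_nn_integral_prod:
  fixes h :: "nat \<Rightarrow> real \<Rightarrow> ennreal"
  assumes EH: "class_EH M N \<sigma> \<tau> lam q" and [measurable]: "\<And>j. h j \<in> borel_measurable borel"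
  shows "(\<integral>\<^sup>+\<omega>. (\<Prod>j<k. h j (holding_time \<tau> (Suc j) \<omega>)) \<partial>M)
      = (\<Prod>j<k. \<integral>\<^sup>+\<omega>. h j (holding_time \<tau> (Suc j) \<omega>) \<partial>M)"
proof -
  have "indep_vars (\<lambda>_. borel) (holding_time \<tau>) {1..k}"
    using EH by (auto simp: class_EH_def intro: indep_vars_subset)
  \<comment> \<open>Holding times are numbered from one and the factors \<open>h j\<close> from
    zero, hence the shift \<open>i - 1\<close>.\<close>
  then have "indep_vars (\<lambda>_. borel) (\<lambda>i \<omega>. h (i - 1) (holding_time \<tau> i \<omega>)) {1..k}"
    by (rule indep_vars_compose2) simp
  from indep_vars_nn_integral[OF _ this] show ?thesis
    by (simp add: prod.atLeast1_atMost_eq)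
qed

text \<open>The law of the mode with index \<open>j\<close>: a point mass at the deterministic
  start, and the distribution of (EH2) afterwards.\<close>

definition mode_law :: "nat \<Rightarrow> (nat \<Rightarrow> real) \<Rightarrow> nat \<Rightarrow> nat \<Rightarrow> real" where
  "mode_law \<sigma>0 q j i = (if j = 0 then of_bool (i = \<sigma>0) else q i)"

text \<open>The event fixing the first \<open>k\<close> modes lies in the algebra that they
  generate. Over it the indicator of the next mode may be replaced by its conditional expectation,
  which is the constant \<open>q (i k)\<close>; induction then gives the product law.\<close>

lemma (in prob_space) class_EH_prob_modes:
  assumes EH: "class_EH M N \<sigma> \<tau> lam q" and start: "AE \<omega> in M. mode_at \<sigma> \<tau> 0 \<omega> = \<sigma>0"
    and i: "\<And>j. j < k \<Longrightarrow> i j \<in> {1..N}"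
  shows "prob {\<omega>\<in>space M. \<forall>j\<in>{..<k}. mode_at \<sigma> \<tau> j \<omega> = i j} = (\<Prod>j<k. mode_law \<sigma>0 q j (i j))"
  using i
proof (induction k)
  case 0
  then show ?case by (simp add: prob_space)
next
  case (Suc k)
  note [measurable] = class_EH_measurable(1)[OF EH]
  let ?A = "{\<omega>\<in>space M. \<forall>j\<in>{..<k}. mode_at \<sigma> \<tau> j \<omega> = i j}"
  let ?B = "{\<omega>\<in>space M. mode_at \<sigma> \<tau> k \<omega> = i k}"
  have eq: "{\<omega>\<in>space M. \<forall>j\<in>{..<Suc k}. mode_at \<sigma> \<tau> j \<omega> = i j} = ?A \<inter> ?B"
    by (auto simp: less_Suc_eq)
  \<comment> \<open>(EH2) concerns indices from one on. For \<open>k = 0\<close> the set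
    \<open>?A\<close> is the whole space and the deterministic start supplies the factor.\<close>
  have "prob (?A \<inter> ?B) = mode_law \<sigma>0 q k (i k) * prob ?A"
  proof (cases "k = 0")
    case True
    have "prob ?B = of_bool (i 0 = \<sigma>0)"
    proof (cases "i 0 = \<sigma>0")
      case True
      then show ?thesis using start \<open>k = 0\<close> by (simp add: prob_Collect_eq_1)
    next
      case False
      with start have "AE \<omega> in M. mode_at \<sigma> \<tau> 0 \<omega> \<noteq> i 0" by (auto elim: AE_mp)
      then show ?thesis using False \<open>k = 0\<close> by (simp add: prob_Collect_eq_0)
    qed
    then show ?thesis using True by (simp add: mode_law_def prob_space)
  next
    case False
    let ?F = "family_algebra M (count_space UNIV) {..<k} (mode_at \<sigma> \<tau>)"
    have sub: "subalgebra M ?F"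
      unfolding subalgebra_def by (simp add: sets_family_algebra_subset)
    interpret F: finite_measure_subalgebra M ?F
      by unfold_locales (rule sub)
    have [measurable]: "mode_at \<sigma> \<tau> j \<in> measurable ?F (count_space UNIV)" if "j \<in> {..<k}" for j
      by (rule measurable_family_algebra) (use that in auto)
    have "{\<omega>\<in>space ?F. \<forall>j\<in>{..<k}. mode_at \<sigma> \<tau> j \<omega> = i j} \<in> sets ?F"
      by measurable
    then have A: "?A \<in> sets ?F" by simp
    have AE: "AE \<omega> in M. real_cond_exp M ?F (indicator ?B) \<omega> = q (i k)"
      using EH False Suc.prems unfolding class_EH_def by auto
    have "prob (?A \<inter> ?B) = (LINT \<omega>:?A|M. indicator ?B \<omega>)"
      by (simp add: set_lebesgue_integral_def indicator_inter_arith[symmetric])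
    also have "\<dots> = (LINT \<omega>:?A|M. real_cond_exp M ?F (indicator ?B) \<omega>)"
      by (rule F.real_cond_exp_intA[OF _ A]) (auto simp: emeasure_eq_measure intro!: integrable_real_indicator)
    also have "\<dots> = (LINT \<omega>:?A|M. q (i k))"
      unfolding set_lebesgue_integral_def
      by (rule integral_cong_AE) (use AE in \<open>measurable, auto elim: AE_mp\<close>)
    also have "\<dots> = q (i k) * prob ?A"
      by (simp add: set_lebesgue_integral_def mult.commute)
    finally show ?thesis using False by (simp add: mode_law_def)
  qed
  then show ?case
    using Suc unfolding eq by (simp add: mult.commute)
qed

text \<open>Decomposing over all mode sequences \<open>g\<close> of length \<open>k\<close> makes
  the modes deterministic inside each term. (EH3) separates the probability of \<open>g\<close> from
  the holding times, and independence of the latter splits the remaining expectation.\<close>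

lemma (in prob_space) class_EH_nn_integral_modes:
  fixes h :: "nat \<Rightarrow> real \<Rightarrow> ennreal"
  assumes EH: "class_EH M N \<sigma> \<tau> lam q" and start: "AE \<omega> in M. mode_at \<sigma> \<tau> 0 \<omega> = \<sigma>0"
    and modes: "AE \<omega> in M. \<forall>j. mode_at \<sigma> \<tau> j \<omega> \<in> {1..N}"
    and h[measurable]: "\<And>i. h i \<in> borel_measurable borel"
    and H: "\<And>i j. i \<in> {1..N} \<Longrightarrow> (\<integral>\<^sup>+\<omega>. h i (holding_time \<tau> (Suc j) \<omega>) \<partial>M) = H i"
  shows "(\<integral>\<^sup>+\<omega>. (\<Prod>j<k. h (mode_at \<sigma> \<tau> j \<omega>) (holding_time \<tau> (Suc j) \<omega>)) \<partial>M)
      = (\<Prod>j<k. \<Sum>i\<in>{1..N}. ennreal (mode_law \<sigma>0 q j i) * H i)"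
proof -
  note [measurable] = class_EH_measurable[OF EH]
  let ?P = "PiE {..<k} (\<lambda>_. {1..N})"
  let ?A = "\<lambda>g. {\<omega>\<in>space M. \<forall>j\<in>{..<k}. mode_at \<sigma> \<tau> j \<omega> = g j}"
  let ?S = "family_algebra M borel {1..} (holding_time \<tau>)"
  let ?G = "family_algebra M (count_space UNIV) UNIV (mode_at \<sigma> \<tau>)"
  have q0: "mode_law \<sigma>0 q j i \<ge> 0" if "i \<in> {1..N}" for i j
    using that EH by (auto simp: mode_law_def class_EH_def)
  \<comment> \<open>Each factor is a sum over modes with a single nonzero term; expanding the
    product of these sums leaves only the sequence \<open>g\<close> that actually occurs.\<close>
  have "(\<Prod>j<k. h (mode_at \<sigma> \<tau> j \<omega>) (holding_time \<tau> (Suc j) \<omega>))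
      = (\<Sum>g\<in>?P. indicator (?A g) \<omega> * (\<Prod>j<k. h (g j) (holding_time \<tau> (Suc j) \<omega>)))"
    if "\<forall>j. mode_at \<sigma> \<tau> j \<omega> \<in> {1..N}" "\<omega> \<in> space M" for \<omega>
  proof -
    have "(\<Prod>j<k. h (mode_at \<sigma> \<tau> j \<omega>) (holding_time \<tau> (Suc j) \<omega>))
        = (\<Prod>j<k. \<Sum>i\<in>{1..N}. of_bool (mode_at \<sigma> \<tau> j \<omega> = i) * h i (holding_time \<tau> (Suc j) \<omega>))"
    proof (rule prod.cong)
      fix j
      have "(\<Sum>i\<in>{1..N}. of_bool (mode_at \<sigma> \<tau> j \<omega> = i) * h i (holding_time \<tau> (Suc j) \<omega>))
          = (\<Sum>i\<in>{1..N}. if mode_at \<sigma> \<tau> j \<omega> = i then h i (holding_time \<tau> (Suc j) \<omega>) else 0)"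
        by (intro sum.cong) auto
      also have "\<dots> = h (mode_at \<sigma> \<tau> j \<omega>) (holding_time \<tau> (Suc j) \<omega>)"
        using that(1) by (subst sum.delta') auto
      finally show "h (mode_at \<sigma> \<tau> j \<omega>) (holding_time \<tau> (Suc j) \<omega>)
        = (\<Sum>i\<in>{1..N}. of_bool (mode_at \<sigma> \<tau> j \<omega> = i) * h i (holding_time \<tau> (Suc j) \<omega>))" ..
    qed simp
    also have "\<dots> = (\<Sum>g\<in>?P. \<Prod>j<k. of_bool (mode_at \<sigma> \<tau> j \<omega> = g j) * h (g j) (holding_time \<tau> (Suc j) \<omega>))"
      by (rule prod_sum_PiE) auto
    also have "\<dots> = (\<Sum>g\<in>?P. indicator (?A g) \<omega> * (\<Prod>j<k. h (g j) (holding_time \<tau> (Suc j) \<omega>)))"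
    proof (rule sum.cong)
      fix g
      have "(\<Prod>j<k. of_bool (mode_at \<sigma> \<tau> j \<omega> = g j)) = (indicator (?A g) \<omega> :: ennreal)"
        using that(2) by (auto simp: indicator_def prod_zero_iff)
      then show "(\<Prod>j<k. of_bool (mode_at \<sigma> \<tau> j \<omega> = g j) * h (g j) (holding_time \<tau> (Suc j) \<omega>))
          = indicator (?A g) \<omega> * (\<Prod>j<k. h (g j) (holding_time \<tau> (Suc j) \<omega>))"
        by (simp add: prod.distrib)
    qed simp
    finally show ?thesis .
  qed
  then have "(\<integral>\<^sup>+\<omega>. (\<Prod>j<k. h (mode_at \<sigma> \<tau> j \<omega>) (holding_time \<tau> (Suc j) \<omega>)) \<partial>M)
      = (\<integral>\<^sup>+\<omega>. (\<Sum>g\<in>?P. indicator (?A g) \<omega> * (\<Prod>j<k. h (g j) (holding_time \<tau> (Suc j) \<omega>))) \<partial>M)"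
    using modes by (intro nn_integral_cong_AE) (auto elim!: AE_mp)
  also have "\<dots> = (\<Sum>g\<in>?P. \<integral>\<^sup>+\<omega>. indicator (?A g) \<omega> * (\<Prod>j<k. h (g j) (holding_time \<tau> (Suc j) \<omega>)) \<partial>M)"
    by (rule nn_integral_sum) simp
  also have "\<dots> = (\<Sum>g\<in>?P. \<Prod>j<k. ennreal (mode_law \<sigma>0 q j (g j)) * H (g j))"
  proof (rule sum.cong)
    fix g assume g: "g \<in> ?P"
    have gN: "g j \<in> {1..N}" if "j < k" for j
      using PiE_mem[OF g, of j] that by simp
    have indep: "indep_set (sets ?S) (sets ?G)"
      using EH by (simp add: class_EH_def)
    have [measurable]: "holding_time \<tau> (Suc j) \<in> borel_measurable ?S" for j
      by (rule measurable_family_algebra) auto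
    have [measurable]: "mode_at \<sigma> \<tau> j \<in> measurable ?G (count_space UNIV)" for j
      by (rule measurable_family_algebra) auto
    have Y: "(\<lambda>\<omega>. \<Prod>j<k. h (g j) (holding_time \<tau> (Suc j) \<omega>)) \<in> borel_measurable ?S"
      by measurable
    have "{\<omega>\<in>space ?G. \<forall>j\<in>{..<k}. mode_at \<sigma> \<tau> j \<omega> = g j} \<in> sets ?G"
      by measurable
    then have A: "?A g \<in> sets ?G" by simp
    have "prob (?A g) = (\<Prod>j<k. mode_law \<sigma>0 q j (g j))"
      by (rule class_EH_prob_modes[OF EH start gN])
    then have "emeasure M (?A g) = ennreal (\<Prod>j<k. mode_law \<sigma>0 q j (g j))"
      by (simp only: emeasure_eq_measure)
    also have "\<dots> = (\<Prod>j<k. ennreal (mode_law \<sigma>0 q j (g j)))"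
      using gN by (intro prod_ennreal[symmetric] q0) simp
    finally have "emeasure M (?A g) = (\<Prod>j<k. ennreal (mode_law \<sigma>0 q j (g j)))" .
    moreover have "(\<integral>\<^sup>+\<omega>. (\<Prod>j<k. h (g j) (holding_time \<tau> (Suc j) \<omega>)) \<partial>M) = (\<Prod>j<k. H (g j))"
      by (simp only: class_EH_nn_integral_prod[OF EH h]) (intro prod.cong refl H gN, simp)
    ultimately show "(\<integral>\<^sup>+\<omega>. indicator (?A g) \<omega> * (\<Prod>j<k. h (g j) (holding_time \<tau> (Suc j) \<omega>)) \<partial>M)
        = (\<Prod>j<k. ennreal (mode_law \<sigma>0 q j (g j)) * H (g j))"
      using nn_integral_indicator_mult_indep[OF indep _ _ Y A] by (simp add: prod.distrib)
  qed simp
  \<comment> \<open>Every term is now a product over \<open>j\<close>, so the sum over sequences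
    folds back into a product of sums.\<close>
  also have "\<dots> = (\<Prod>j<k. \<Sum>i\<in>{1..N}. ennreal (mode_law \<sigma>0 q j i) * H i)"
    by (rule prod_sum_PiE[symmetric]) auto
  finally show ?thesis .
qed

text \<open>A Chernoff bound: \<open>\<tau> k \<le> n\<close> has probability at most
  \<open>exp n\<close> times the mean of \<open>exp (- \<tau> k)\<close>, which is
  \<open>(lam / (lam + 1)) ^ k\<close> and tends to zero. It rules out accumulation of switching
  instants, so every time lies in some holding interval.\<close>

lemma (in prob_space) class_EH_unbounded:
  assumes EH: "class_EH M N \<sigma> \<tau> lam q" and start: "AE \<omega> in M. \<tau> 0 \<omega> = 0"
    and [measurable]: "\<And>k. \<tau> k \<in> borel_measurable M"
  shows "AE \<omega> in M. \<forall>B. \<exists>k. \<tau> k \<omega> > B"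
proof -
  have lam: "lam > 0" using EH by (simp add: class_EH_def)
  have "AE \<omega> in M. \<exists>k. \<tau> k \<omega> > real n" for n
  proof -
    let ?A = "{\<omega>\<in>space M. \<forall>k. \<tau> k \<omega> \<le> real n}"
    have "emeasure M ?A \<le> ennreal (exp n * (lam / (lam + 1)) ^ k)" for k
    proof -
      have "emeasure M ?A = (\<integral>\<^sup>+\<omega>. indicator ?A \<omega> \<partial>M)" by simp
      also have "\<dots> \<le> (\<integral>\<^sup>+\<omega>. ennreal (exp n) * (\<Prod>j<k. ennreal (exp (- 1 * holding_time \<tau> (Suc j) \<omega>))) \<partial>M)"
      proof (rule nn_integral_mono_AE, use start in eventually_elim)
        fix \<omega> assume "\<tau> 0 \<omega> = 0"
        then have "(\<Sum>j<k. holding_time \<tau> (Suc j) \<omega>) = \<tau> k \<omega>"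
          using sum_lessThan_telescope[of "\<lambda>j. \<tau> j \<omega>" k] by (simp add: holding_time_def)
        then have "(\<Prod>j<k. ennreal (exp (- 1 * holding_time \<tau> (Suc j) \<omega>))) = ennreal (exp (- \<tau> k \<omega>))"
          by (simp add: prod_ennreal exp_sum[symmetric] sum_negf)
        moreover have "1 \<le> ennreal (exp n * exp (- \<tau> k \<omega>))" if "\<omega> \<in> ?A"
          using that by (simp add: mult_exp_exp)
        ultimately show "indicator ?A \<omega> \<le> ennreal (exp n) * (\<Prod>j<k. ennreal (exp (- 1 * holding_time \<tau> (Suc j) \<omega>)))"
          by (auto simp: ennreal_mult' split: split_indicator)
      qed
      also have "\<dots> = ennreal (exp n) * (\<Prod>j<k. \<integral>\<^sup>+\<omega>. ennreal (exp (- 1 * holding_time \<tau> (Suc j) \<omega>)) \<partial>M)"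
        using class_EH_measurable(2)[OF EH]
        by (subst nn_integral_cmult, measurable) (subst class_EH_nn_integral_prod[OF EH], simp_all)
      also have "\<dots> = ennreal (exp n * (lam / (lam + 1)) ^ k)"
        using lam by (subst nn_integral_exp_exponential_distributed[OF class_EH_distributed[OF EH]])
          (auto simp: ennreal_mult' ennreal_power)
      finally show ?thesis .
    qed
    moreover have "(\<lambda>k. ennreal (exp n * (lam / (lam + 1)) ^ k)) \<longlonglongrightarrow> ennreal (exp n * 0)"
      using lam by (intro tendsto_ennrealI tendsto_intros LIMSEQ_realpow_zero) auto
    ultimately have "emeasure M ?A \<le> 0"
      by (intro LIMSEQ_le_const[of "\<lambda>k. ennreal (exp n * (lam / (lam + 1)) ^ k)"]) auto
    then have "?A \<in> null_sets M" by (auto simp: null_sets_def)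
    from AE_not_in[OF this] AE_space show ?thesis
      by eventually_elim (auto simp: not_le)
  qed
  then have "AE \<omega> in M. \<forall>n. \<exists>k. \<tau> k \<omega> > real n" by (simp add: AE_all_countable)
  then show ?thesis
    by eventually_elim (meson less_trans reals_Archimedean2)
qed

subsection \<open>Lyapunov functions along switched trajectories\<close>

text \<open>Induction over the switching instants collects one factor of \<open>Z\<close> per
  holding interval: \<open>\<mu>\<close> pays for the change of mode, the exponential for the flow.
  The last, incomplete interval is bounded without knowing the sign of its rate.\<close>

lemma switched_lyapunov_path:
  fixes y :: "real \<Rightarrow> 'a::euclidean_space" and s :: "real \<Rightarrow> 'i" and T :: "nat \<Rightarrow> real"
    and l :: "'i \<Rightarrow> real" and c \<mu> :: real
  defines "Z \<equiv> \<lambda>k. \<Prod>j<k. \<mu> * exp (- (l (s (T j)) - c) * (T (Suc j) - T j))"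
  assumes T0: "T 0 = 0" and inc: "\<And>k. T k < T (Suc k)"
    and const: "\<And>k t. T k \<le> t \<Longrightarrow> t < T (Suc k) \<Longrightarrow> s t = s (T k)"
    and modes: "\<And>k. s (T k) \<in> P"
    and ac: "\<And>b. b \<ge> 0 \<Longrightarrow> abs_continuous_between 0 b y"
    and ode: "AE t in lborel. 0 \<le> t \<longrightarrow> (y has_vector_derivative f (s t) (y t)) (at t within {0..})"
    and f: "\<And>i. i \<in> P \<Longrightarrow> continuous_on UNIV (f i)"
    and V: "\<And>i z. i \<in> P \<Longrightarrow> GDERIV (V i) z :> V' i z"
    and V0: "\<And>i z. i \<in> P \<Longrightarrow> V i z \<ge> 0"
    and decay: "\<And>i z. i \<in> P \<Longrightarrow> V' i z \<bullet> f i z \<le> - l i * V i z"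
    and \<mu>: "\<mu> \<ge> 1" and jump: "\<And>i j z. i \<in> P \<Longrightarrow> j \<in> P \<Longrightarrow> V i z \<le> \<mu> * V j z"
    and t: "T k \<le> t" "t < T (Suc k)"
  shows "V (s t) (y t) \<le> exp (- c * t) * V (s 0) (y 0) * (Z k + Z (Suc k))"
proof -
  have mono: "T i \<le> T j" if "i \<le> j" for i j
    using lift_Suc_mono_le[of T, OF _ that] inc less_imp_le by blast
  have T_nonneg: "T k \<ge> 0" for k
    using mono[of 0 k] T0 by simp
  obtain E where E: "{t \<in> space lborel. \<not> (0 \<le> t \<longrightarrow> (y has_vector_derivative f (s t) (y t)) (at t within {0..}))} \<subseteq> E"
      "emeasure lborel E = 0" "E \<in> sets lborel"
    using ode by (rule AE_E)
  have "E \<in> null_sets lborel" using E by auto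
  then have negE: "negligible E"
    using null_sets_completionI by (simp add: negligible_iff_null_sets)
  have seg: "V (s (T k)) (y t) \<le> V (s (T k)) (y (T k)) * exp (- l (s (T k)) * (t - T k))"
    if "T k \<le> t" "t \<le> T (Suc k)" for k t
  \<comment> \<open>At \<open>T (Suc k)\<close> the signal may already have its next value, so the
    differential equation with field \<open>f (s (T k))\<close> can fail there. Adding this one
    point keeps the exceptional set negligible.\<close>
  proof (rule lyapunov_exponential_bound[where f = "f (s (T k))" and E = "insert (T (Suc k)) E"])
    show "abs_continuous_between (T k) t y"
      using that T_nonneg[of k] by (intro abs_continuous_between_subinterval[OF ac[of t]]) auto
    show "negligible (insert (T (Suc k)) E)" using negE by simp
    show "(y has_vector_derivative f (s (T k)) (y u)) (at u within {T k..t})"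
      if u: "u \<in> {T k..t} - insert (T (Suc k)) E" for u
    proof -
      have "s u = s (T k)" using u \<open>t \<le> T (Suc k)\<close> by (intro const) auto
      moreover have "(y has_vector_derivative f (s u) (y u)) (at u within {0..})"
      proof -
        have "0 \<le> u" "u \<notin> E" using u T_nonneg[of k] by auto
        then show ?thesis using E(1) by auto
      qed
      ultimately show ?thesis
        using T_nonneg[of k] by (auto elim!: has_vector_derivative_within_subset)
    qed
  qed (use that modes f V decay in auto)
  have node: "exp (c * T k) * V (s (T k)) (y (T k)) \<le> V (s 0) (y 0) * Z k" for k
  proof (induction k)
    case 0
    then show ?case by (simp add: T0 Z_def)
  next
    case (Suc k)
    let ?l = "l (s (T k))" and ?d = "T (Suc k) - T k"
    have "V (s (T (Suc k))) (y (T (Suc k))) \<le> \<mu> * V (s (T k)) (y (T (Suc k)))"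
      by (intro jump modes)
    also have "\<dots> \<le> \<mu> * (V (s (T k)) (y (T k)) * exp (- ?l * ?d))"
      using seg[of k "T (Suc k)"] inc[of k] \<mu> by (intro mult_left_mono) auto
    finally have "exp (c * T (Suc k)) * V (s (T (Suc k))) (y (T (Suc k)))
        \<le> exp (c * T (Suc k)) * (\<mu> * (V (s (T k)) (y (T k)) * exp (- ?l * ?d)))"
      by (intro mult_left_mono) auto
    also have "\<dots> = exp (c * T k) * V (s (T k)) (y (T k)) * (\<mu> * (exp (c * ?d) * exp (- ?l * ?d)))"
    proof -
      have "exp (c * T (Suc k)) = exp (c * T k) * exp (c * ?d)"
        by (simp add: mult_exp_exp algebra_simps)
      then show ?thesis by (simp only: mult_ac)
    qed
    also have "exp (c * ?d) * exp (- ?l * ?d) = exp (- (?l - c) * ?d)"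
      by (simp add: mult_exp_exp algebra_simps)
    also have "exp (c * T k) * V (s (T k)) (y (T k)) * (\<mu> * exp (- (?l - c) * ?d))
        \<le> V (s 0) (y 0) * Z k * (\<mu> * exp (- (?l - c) * ?d))"
      using \<mu> by (intro mult_right_mono Suc.IH) auto
    also have "\<dots> = V (s 0) (y 0) * Z (Suc k)"
      by (simp add: Z_def mult_ac)
    finally show ?case .
  qed
  let ?l = "l (s (T k))" and ?d = "T (Suc k) - T k" and ?u = "t - T k"
  have Z0: "Z k \<ge> 0" using \<mu> by (auto simp: Z_def intro!: prod_nonneg)
  have V00: "V (s 0) (y 0) \<ge> 0" using V0[OF modes[of 0]] T0 by simp
  \<comment> \<open>If the rate is at least \<open>c\<close>, the constant \<open>1\<close>
    dominates; otherwise the exponential grows and its value over the full interval dominates. The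
    factor \<open>\<mu>\<close> is inserted to make the right side equal to
    \<open>Z (Suc k) / Z k + 1\<close>.\<close>
  have exp_bound: "exp (- (?l - c) * ?u) \<le> 1 + \<mu> * exp (- (?l - c) * ?d)"
  proof (cases "?l \<ge> c")
    case True
    then have "exp (- (?l - c) * ?u) \<le> 1" using t by (simp add: mult_nonpos_nonneg)
    then show ?thesis using \<mu> by (simp add: add_increasing2)
  next
    case False
    then have "- (?l - c) * ?u \<le> - (?l - c) * ?d" using t by (intro mult_left_mono) auto
    then have "exp (- (?l - c) * ?u) \<le> 1 * exp (- (?l - c) * ?d)" by simp
    also have "\<dots> \<le> \<mu> * exp (- (?l - c) * ?d)" using \<mu> by (intro mult_right_mono) auto
    finally show ?thesis by linarith
  qed
  have "V (s t) (y t) = V (s (T k)) (y t)" using const[OF t] by simp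
  also have "\<dots> \<le> V (s (T k)) (y (T k)) * exp (- ?l * ?u)"
    using t by (intro seg) auto
  also have "\<dots> = exp (- c * t) * (exp (c * T k) * V (s (T k)) (y (T k))) * exp (- (?l - c) * ?u)"
  proof -
    have "exp (- ?l * ?u) = exp (- c * t) * exp (c * T k) * exp (- (?l - c) * ?u)"
      by (simp add: mult_exp_exp algebra_simps)
    then show ?thesis by (simp only: mult_ac)
  qed
  also have "\<dots> \<le> exp (- c * t) * (V (s 0) (y 0) * Z k) * (1 + \<mu> * exp (- (?l - c) * ?d))"
    using Z0 V00 by (intro mult_mono node exp_bound mult_left_mono mult_nonneg_nonneg) auto
  also have "\<dots> = exp (- c * t) * V (s 0) (y 0) * (Z k + Z (Suc k))"
    by (simp add: Z_def algebra_simps)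
  finally show ?thesis .
qed

text \<open>The mean weights form a geometric series of ratio \<open>\<rho>\<close> after two
  special terms: the empty product, and the first holding interval, whose mode is fixed at
  \<open>\<sigma>0\<close> instead of being averaged by \<open>q\<close>.\<close>

lemma (in prob_space) class_EH_nn_integral_weights:
  fixes lami q :: "nat \<Rightarrow> real" and \<mu> c lam :: real and N :: nat
    and \<sigma> :: "real \<Rightarrow> 'a \<Rightarrow> nat" and \<tau> :: "nat \<Rightarrow> 'a \<Rightarrow> real"
  defines "W \<equiv> \<lambda>k \<omega>. \<Prod>j<k. ennreal (\<mu> * exp (- (lami (mode_at \<sigma> \<tau> j \<omega>) - c) * holding_time \<tau> (Suc j) \<omega>))"
    and "\<rho> \<equiv> \<Sum>i\<in>{1..N}. \<mu> * q i * lam / (lam + lami i - c)"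
  assumes EH: "class_EH M N \<sigma> \<tau> lam q" and start: "AE \<omega> in M. mode_at \<sigma> \<tau> 0 \<omega> = \<sigma>0"
    and modes: "AE \<omega> in M. \<forall>j. mode_at \<sigma> \<tau> j \<omega> \<in> {1..N}" and \<sigma>0: "\<sigma>0 \<in> {1..N}"
    and \<mu>: "\<mu> \<ge> 0" and pos: "\<And>i. i \<in> {1..N} \<Longrightarrow> lam + lami i - c > 0" and "\<rho> < 1"
  shows "(\<integral>\<^sup>+\<omega>. (\<Sum>k. W k \<omega>) \<partial>M)
      = ennreal (1 + \<mu> * lam / (lam + lami \<sigma>0 - c) / (1 - \<rho>))"
proof -
  note [measurable] = class_EH_measurable[OF EH]
  have lam: "lam > 0" and q: "\<And>i. i \<in> {1..N} \<Longrightarrow> q i \<ge> 0"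
    using EH by (auto simp: class_EH_def)
  define H where "H i = \<mu> * lam / (lam + lami i - c)" for i
  have H0: "H i \<ge> 0" if "i \<in> {1..N}" for i
    using \<mu> lam pos[OF that] by (simp add: H_def)
  have \<rho>_eq: "\<rho> = (\<Sum>i\<in>{1..N}. q i * H i)"
    by (simp add: \<rho>_def H_def mult_ac)
  have \<rho>0: "\<rho> \<ge> 0"
    unfolding \<rho>_eq using q H0 by (intro sum_nonneg mult_nonneg_nonneg)
  \<comment> \<open>\<open>w k\<close> is the mean of \<open>W k\<close>. The power of
    \<open>\<rho>\<close> lags by one behind the index because the first factor contributes
    \<open>H \<sigma>0\<close>.\<close>
  define w where "w k = (case k of 0 \<Rightarrow> 1 | Suc k \<Rightarrow> H \<sigma>0 * \<rho> ^ k)" for k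
  have w0: "w k \<ge> 0" for k
    using H0[OF \<sigma>0] \<rho>0 by (auto simp: w_def split: nat.split)
  have "(\<integral>\<^sup>+\<omega>. W k \<omega> \<partial>M) = ennreal (w k)" for k
  proof -
    have "(\<integral>\<^sup>+\<omega>. ennreal (\<mu> * exp (- (lami i - c) * holding_time \<tau> (Suc j) \<omega>)) \<partial>M) = ennreal (H i)"
      if i: "i \<in> {1..N}" for i j
    proof -
      have "(\<integral>\<^sup>+\<omega>. ennreal (\<mu> * exp (- (lami i - c) * holding_time \<tau> (Suc j) \<omega>)) \<partial>M)
          = ennreal \<mu> * (\<integral>\<^sup>+\<omega>. ennreal (exp (- (lami i - c) * holding_time \<tau> (Suc j) \<omega>)) \<partial>M)"
        using \<mu> by (subst nn_integral_cmult[symmetric]) (auto simp: ennreal_mult)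
      also have "\<dots> = ennreal \<mu> * ennreal (lam / (lam + (lami i - c)))"
        using lam pos[OF i]
        by (subst nn_integral_exp_exponential_distributed[OF class_EH_distributed[OF EH]]) auto
      also have "\<dots> = ennreal (H i)"
        using \<mu> lam pos[OF i] by (simp add: H_def ennreal_mult[symmetric] add_diff_eq)
      finally show ?thesis .
    qed
    then have "(\<integral>\<^sup>+\<omega>. W k \<omega> \<partial>M) = (\<Prod>j<k. \<Sum>i\<in>{1..N}. ennreal (mode_law \<sigma>0 q j i) * ennreal (H i))"
      unfolding W_def
      by (intro class_EH_nn_integral_modes[OF EH start modes, where h = "\<lambda>i s. ennreal (\<mu> * exp (- (lami i - c) * s))"]) auto
    also have "\<dots> = (\<Prod>j<k. ennreal (if j = 0 then H \<sigma>0 else \<rho>))"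
    proof (rule prod.cong)
      fix j
      show "(\<Sum>i\<in>{1..N}. ennreal (mode_law \<sigma>0 q j i) * ennreal (H i)) = ennreal (if j = 0 then H \<sigma>0 else \<rho>)"
      proof (cases "j = 0")
        case True
        have "(\<Sum>i\<in>{1..N}. ennreal (mode_law \<sigma>0 q j i) * ennreal (H i))
            = (\<Sum>i\<in>{1..N}. if i = \<sigma>0 then ennreal (H i) else 0)"
          using True by (intro sum.cong) (auto simp: mode_law_def)
        then show ?thesis using True \<sigma>0 by (simp add: sum.delta)
      next
        case False
        have "(\<Sum>i\<in>{1..N}. ennreal (mode_law \<sigma>0 q j i) * ennreal (H i))
            = (\<Sum>i\<in>{1..N}. ennreal (q i * H i))"
          using False q H0 by (intro sum.cong) (auto simp: mode_law_def ennreal_mult)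
        also have "\<dots> = ennreal \<rho>"
          unfolding \<rho>_eq using q H0 by (intro sum_ennreal) auto
        finally show ?thesis using False by simp
      qed
    qed simp
    also have "\<dots> = ennreal (w k)"
    proof (cases k)
      case (Suc m)
      then show ?thesis
        using H0[OF \<sigma>0] \<rho>0
        by (simp add: w_def prod.lessThan_Suc_shift ennreal_mult ennreal_power del: prod.lessThan_Suc)
    qed (simp add: w_def)
    finally show ?thesis .
  qed
  then have "(\<integral>\<^sup>+\<omega>. (\<Sum>k. W k \<omega>) \<partial>M) = (\<Sum>k. ennreal (w k))"
    by (subst nn_integral_suminf) (auto simp: W_def)
  also have "\<dots> = ennreal (H \<sigma>0 * (1 / (1 - \<rho>)) + w 0)"
  proof (rule suminf_ennreal_eq[OF w0])
    have "(\<lambda>k. w (Suc k)) sums (H \<sigma>0 * (1 / (1 - \<rho>)))"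
      unfolding w_def nat.case using \<rho>0 \<open>\<rho> < 1\<close> by (intro sums_mult geometric_sums) simp
    then show "w sums (H \<sigma>0 * (1 / (1 - \<rho>)) + w 0)" by (rule sums_Suc)
  qed
  also have "H \<sigma>0 * (1 / (1 - \<rho>)) + w 0 = 1 + \<mu> * lam / (lam + lami \<sigma>0 - c) / (1 - \<rho>)"
    by (simp add: H_def w_def)
  finally show ?thesis .
qed

text \<open>The finite sum is continuous from the right at \<open>c = 0\<close>, where (E3) keeps
  the denominators positive and (E4) bounds it strictly below one. Strict inequalities persist for
  small \<open>c > 0\<close>.\<close>

lemma decay_rate_exists:
  fixes lami q :: "nat \<Rightarrow> real" and \<mu> lam :: real
  assumes lam: "lam > 0" and pos: "\<And>i. i \<in> {1..N} \<Longrightarrow> lami i + lam > 0"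
    and less: "(\<Sum>i\<in>{1..N}. \<mu> * q i / (1 + lami i / lam)) < 1"
  obtains c where "c > 0" "\<And>i. i \<in> {1..N} \<Longrightarrow> lam + lami i - c > 0"
    "(\<Sum>i\<in>{1..N}. \<mu> * q i * lam / (lam + lami i - c)) < 1"
proof -
  \<comment> \<open>The literal \<open>- 0\<close> keeps the sum in the form of the limit of the
    family in \<open>c\<close>.\<close>
  have "(\<Sum>i\<in>{1..N}. \<mu> * q i * lam / (lam + lami i - 0)) = (\<Sum>i\<in>{1..N}. \<mu> * q i / (1 + lami i / lam))"
    using lam by (intro sum.cong) (auto simp: field_simps)
  with less have less': "(\<Sum>i\<in>{1..N}. \<mu> * q i * lam / (lam + lami i - 0)) < 1" by simp
  have "((\<lambda>c. \<Sum>i\<in>{1..N}. \<mu> * q i * lam / (lam + lami i - c)) \<longlongrightarrow>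
      (\<Sum>i\<in>{1..N}. \<mu> * q i * lam / (lam + lami i - 0))) (at_right 0)"
    using pos by (intro tendsto_intros) (force simp: add.commute)
  then have "eventually (\<lambda>c. (\<Sum>i\<in>{1..N}. \<mu> * q i * lam / (lam + lami i - c)) < 1) (at_right 0)"
    using less' by (rule order_tendstoD)
  moreover have "eventually (\<lambda>c. \<forall>i\<in>{1..N}. lam + lami i - c > 0) (at_right 0)"
  proof (intro eventually_ball_finite ballI)
    fix i assume "i \<in> {1..N}"
    then have "eventually (\<lambda>c. c < lam + lami i) (at_right 0)"
      using pos[of i] by (intro order_tendstoD[OF tendsto_ident_at]) auto
    then show "eventually (\<lambda>c. lam + lami i - c > 0) (at_right 0)"
      by eventually_elim simp
  qed simp
  moreover have "eventually (\<lambda>c. c > 0) (at_right (0::real))"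
    by (rule eventually_at_right_less)
  ultimately have "eventually (\<lambda>c. c > 0 \<and> (\<forall>i\<in>{1..N}. lam + lami i - c > 0) \<and>
      (\<Sum>i\<in>{1..N}. \<mu> * q i * lam / (lam + lami i - c)) < 1) (at_right 0)"
    by eventually_elim auto
  from eventually_happens'[OF _ this] that show ?thesis by auto
qed

section \<open>Comparison functions and stability from an exponential bound\<close>

lemma class_K_mono:
  assumes "class_K \<alpha>" "0 \<le> r" "r \<le> s"
  shows "\<alpha> r \<le> \<alpha> s"
proof (cases "r = s")
  case False
  have "strict_mono_on {0..} \<alpha>" using assms(1) by (simp add: class_K_def)
  from strict_mono_onD[OF this, of r s] show ?thesis using assms(2,3) False by simp
qed simp

lemma class_K_nonneg:
  assumes "class_K \<alpha>" "r \<ge> 0"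
  shows "\<alpha> r \<ge> 0"
  using class_K_mono[of \<alpha> 0 r] assms by (simp add: class_K_def)

lemma class_K_small:
  assumes "class_K \<alpha>" "\<epsilon> > 0"
  obtains \<delta> where "\<delta> > 0" "\<And>r. 0 \<le> r \<Longrightarrow> r < \<delta> \<Longrightarrow> \<alpha> r < \<epsilon>"
proof -
  have "continuous_on {0..} \<alpha>" "\<alpha> 0 = 0" using assms(1) by (auto simp: class_K_def)
  then obtain \<delta> where "\<delta> > 0" and \<delta>: "\<And>r. r \<in> {0..} \<Longrightarrow> dist r 0 < \<delta> \<Longrightarrow> dist (\<alpha> r) 0 < \<epsilon>"
    using \<open>\<epsilon> > 0\<close> unfolding continuous_on_iff by (metis atLeast_iff order_refl)
  show thesis
  proof (rule that[OF \<open>\<delta> > 0\<close>])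
    show "\<alpha> r < \<epsilon>" if "0 \<le> r" "r < \<delta>" for r
      using \<delta>[of r] that by (simp add: dist_norm abs_less_iff)
  qed
qed

text \<open>Both stability conditions follow since \<open>K\<close> and \<open>c\<close> are the
  same for all solutions: (SM1) from smallness of \<open>\<alpha>2\<close> near zero together with
  \<open>exp (- c * t) \<le> 1\<close>, (SM2) from the decay in \<open>t\<close>.\<close>

lemma gas_in_mean_if_exponential_bound:
  assumes \<alpha>2: "class_K \<alpha>2" and "c > 0" "K > 0"
    and bound: "\<And>x0 x t. switched_solution M f \<sigma> x0 x \<Longrightarrow> t \<ge> 0 \<Longrightarrow>
      (\<integral>\<^sup>+\<omega>. ennreal (\<alpha> (norm (x t \<omega>))) \<partial>M) \<le> ennreal (K * exp (- c * t) * \<alpha>2 (norm x0))"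
  shows "gas_in_mean M f \<sigma> \<alpha>"
  unfolding gas_in_mean_def
proof (intro conjI allI impI)
  fix \<epsilon> :: real assume "\<epsilon> > 0"
  \<comment> \<open>Halving leaves room for the supremum, since strict bounds at each time only give
    a weak bound on it.\<close>
  then have "\<epsilon> / 2 / K > 0" using \<open>K > 0\<close> by simp
  from class_K_small[OF \<alpha>2 this] obtain \<delta>
    where "\<delta> > 0" and \<delta>: "\<And>r. 0 \<le> r \<Longrightarrow> r < \<delta> \<Longrightarrow> \<alpha>2 r < \<epsilon> / 2 / K" by metis
  have "(SUP t\<in>{0..}. \<integral>\<^sup>+\<omega>. ennreal (\<alpha> (norm (x t \<omega>))) \<partial>M) < ennreal \<epsilon>"
    if "switched_solution M f \<sigma> x0 x" "norm x0 < \<delta>" for x0 x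
  proof -
    have "(\<integral>\<^sup>+\<omega>. ennreal (\<alpha> (norm (x t \<omega>))) \<partial>M) \<le> ennreal (\<epsilon> / 2)" if "t \<ge> 0" for t
    proof -
      have "K * exp (- c * t) * \<alpha>2 (norm x0) \<le> K * 1 * (\<epsilon> / 2 / K)"
        using \<delta>[of "norm x0"] \<open>norm x0 < \<delta>\<close> \<open>K > 0\<close> \<open>c > 0\<close> that class_K_nonneg[OF \<alpha>2, of "norm x0"]
        by (intro mult_mono) auto
      then have "K * exp (- c * t) * \<alpha>2 (norm x0) \<le> \<epsilon> / 2" using \<open>K > 0\<close> by simp
      then show ?thesis
        using bound[OF \<open>switched_solution M f \<sigma> x0 x\<close> that] by (metis ennreal_leI order_trans)
    qed
    then have "(SUP t\<in>{0..}. \<integral>\<^sup>+\<omega>. ennreal (\<alpha> (norm (x t \<omega>))) \<partial>M) \<le> ennreal (\<epsilon> / 2)"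
      by (intro SUP_least) auto
    also have "\<dots> < ennreal \<epsilon>" using \<open>\<epsilon> > 0\<close> by (simp add: ennreal_less_iff)
    finally show ?thesis .
  qed
  then show "\<exists>\<delta>>0. \<forall>x0 x. switched_solution M f \<sigma> x0 x \<and> norm x0 < \<delta> \<longrightarrow>
      (SUP t\<in>{0..}. \<integral>\<^sup>+\<omega>. ennreal (\<alpha> (norm (x t \<omega>))) \<partial>M) < ennreal \<epsilon>"
    using \<open>\<delta> > 0\<close> by (intro exI[of _ \<delta>]) auto
next
  fix r \<epsilon> :: real assume "r > 0" "\<epsilon> > 0"
  have "filterlim (\<lambda>t. - c * t) at_bot at_top"
    by (rule filterlim_tendsto_neg_mult_at_bot[OF tendsto_const _ filterlim_ident])
      (use \<open>c > 0\<close> in simp)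
  \<comment> \<open>With \<open>\<alpha>2 r\<close> in place of \<open>\<alpha>2 (norm x0)\<close>
    the waiting time is uniform over the ball of radius \<open>r\<close>.\<close>
  then have "((\<lambda>t. K * exp (- c * t) * \<alpha>2 r) \<longlongrightarrow> K * 0 * \<alpha>2 r) at_top"
    by (intro tendsto_intros filterlim_compose[OF exp_at_bot])
  then have "eventually (\<lambda>t. K * exp (- c * t) * \<alpha>2 r < \<epsilon> / 2) at_top"
    using \<open>\<epsilon> > 0\<close> by (intro order_tendstoD(2)) auto
  then obtain T' where T': "\<And>t. t \<ge> T' \<Longrightarrow> K * exp (- c * t) * \<alpha>2 r < \<epsilon> / 2"
    by (auto simp: eventually_at_top_linorder)
  define T where "T = max 0 T'"
  have "(SUP t\<in>{T..}. \<integral>\<^sup>+\<omega>. ennreal (\<alpha> (norm (x t \<omega>))) \<partial>M) < ennreal \<epsilon>"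
    if "switched_solution M f \<sigma> x0 x" "norm x0 < r" for x0 x
  proof -
    have "(\<integral>\<^sup>+\<omega>. ennreal (\<alpha> (norm (x t \<omega>))) \<partial>M) \<le> ennreal (\<epsilon> / 2)" if "t \<ge> T" for t
    proof -
      have "K * exp (- c * t) * \<alpha>2 (norm x0) \<le> K * exp (- c * t) * \<alpha>2 r"
        using \<open>norm x0 < r\<close> \<open>K > 0\<close> class_K_mono[OF \<alpha>2, of "norm x0" r] by (intro mult_left_mono) auto
      also have "\<dots> \<le> \<epsilon> / 2" using T'[of t] that by (simp add: T_def)
      finally show ?thesis
        using bound[OF \<open>switched_solution M f \<sigma> x0 x\<close>, of t] that
        by (metis T_def ennreal_leI max.bounded_iff order_trans)
    qed
    then have "(SUP t\<in>{T..}. \<integral>\<^sup>+\<omega>. ennreal (\<alpha> (norm (x t \<omega>))) \<partial>M) \<le> ennreal (\<epsilon> / 2)"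
      by (intro SUP_least) auto
    also have "\<dots> < ennreal \<epsilon>" using \<open>\<epsilon> > 0\<close> by (simp add: ennreal_less_iff)
    finally show ?thesis .
  qed
  then show "\<exists>T\<ge>0. \<forall>x0 x. switched_solution M f \<sigma> x0 x \<and> norm x0 < r \<longrightarrow>
      (SUP t\<in>{T..}. \<integral>\<^sup>+\<omega>. ennreal (\<alpha> (norm (x t \<omega>))) \<partial>M) < ennreal \<epsilon>"
    by (intro exI[of _ T]) (auto simp: T_def)
qed

section \<open>Exponential decay in the mean of the switched system\<close>

theorem corollary3p3:
  fixes M :: "'w measure"
    and N \<sigma>0 :: nat
    and f :: "nat \<Rightarrow> real ^ 'n \<Rightarrow> real ^ 'n"
    and \<sigma> :: "real \<Rightarrow> 'w \<Rightarrow> nat"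
    and \<tau> :: "nat \<Rightarrow> 'w \<Rightarrow> real"
    and V :: "nat \<Rightarrow> real ^ 'n \<Rightarrow> real"
    and gradV :: "nat \<Rightarrow> real ^ 'n \<Rightarrow> real ^ 'n"
    and \<alpha>1 \<alpha>2 :: "real \<Rightarrow> real"
    and \<mu> lam :: real
    and lami q :: "nat \<Rightarrow> real"
  assumes "prob_space M" and "complete_measure M"
    and "\<And>i. i \<in> {1..N} \<Longrightarrow> local_lipschitz (UNIV :: real set) UNIV (\<lambda>_. f i)"
    and "\<And>i. i \<in> {1..N} \<Longrightarrow> f i 0 = 0"
    and "\<sigma>0 \<in> {1..N}"
    and "switching_signal M N \<sigma>0 \<sigma> \<tau>"
    \<comment> \<open>(E1)\<close>
    and "\<And>i x. i \<in> {1..N} \<Longrightarrow> GDERIV (V i) x :> gradV i x"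
    and "\<And>i. i \<in> {1..N} \<Longrightarrow> continuous_on UNIV (gradV i)"
    and "class_K_inf \<alpha>1" and "class_K_inf \<alpha>2" and "\<mu> > 1"
    and "\<And>i x. i \<in> {1..N} \<Longrightarrow> \<alpha>1 (norm x) \<le> V i x \<and> V i x \<le> \<alpha>2 (norm x)"
    and "\<And>i x. i \<in> {1..N} \<Longrightarrow> gradV i x \<bullet> f i x \<le> - lami i * V i x"
    and "\<And>i j x. i \<in> {1..N} \<Longrightarrow> j \<in> {1..N} \<Longrightarrow> V i x \<le> \<mu> * V j x"
    \<comment> \<open>(E2)\<close>
    and "class_EH M N \<sigma> \<tau> lam q"
    \<comment> \<open>(E3)\<close>
    and "\<And>i. i \<in> {1..N} \<Longrightarrow> lami i + lam > 0"
    \<comment> \<open>(E4)\<close>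
    and "(\<Sum>i\<in>{1..N}. \<mu> * q i / (1 + lami i / lam)) < 1"
  shows "gas_in_mean M f \<sigma> \<alpha>1"
proof -
  note f_lip = assms(3) and \<sigma>0 = assms(5) and signal = assms(6) and V_grad = assms(7)
    and \<alpha>1 = assms(9) and \<alpha>2 = assms(10) and \<mu> = assms(11) and V_bounds = assms(12)
    and V_decay = assms(13) and V_jump = assms(14) and EH = assms(15)
  interpret prob_space M by fact
  have lam: "lam > 0" using EH by (simp add: class_EH_def)
  obtain c where "c > 0" and c: "\<And>i. i \<in> {1..N} \<Longrightarrow> lam + lami i - c > 0"
      "(\<Sum>i\<in>{1..N}. \<mu> * q i * lam / (lam + lami i - c)) < 1"
    using decay_rate_exists[OF lam assms(16,17)] by metis
  have f_cont: "continuous_on UNIV (f i)" if "i \<in> {1..N}" for i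
    by (rule local_lipschitz_continuous_on[OF f_lip[OF that]]) simp
  have K\<alpha>1: "class_K \<alpha>1" and K\<alpha>2: "class_K \<alpha>2"
    using \<alpha>1 \<alpha>2 by (auto simp: class_K_inf_def)
  have V_nonneg: "V i z \<ge> 0" if "i \<in> {1..N}" for i z
    using V_bounds[OF that, of z] class_K_nonneg[OF K\<alpha>1, of "norm z"] by simp
  have paths: "AE \<omega> in M. \<tau> 0 \<omega> = 0 \<and> (\<forall>i. \<tau> i \<omega> < \<tau> (Suc i) \<omega>) \<and>
      (\<forall>i t. \<tau> i \<omega> \<le> t \<and> t < \<tau> (Suc i) \<omega> \<longrightarrow> \<sigma> t \<omega> = \<sigma> (\<tau> i \<omega>) \<omega>)"
    and \<sigma>_start: "\<And>\<omega>. \<omega> \<in> space M \<Longrightarrow> \<sigma> 0 \<omega> = \<sigma>0"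
    and \<tau>_meas: "\<And>i. \<tau> i \<in> borel_measurable M"
    using signal by (auto simp: switching_signal_def)
  have \<sigma>_range: "\<sigma> t \<omega> \<in> {1..N}" if "t \<ge> 0" "\<omega> \<in> space M" for t \<omega>
  proof -
    have "\<sigma> t \<in> measurable M (count_space {1..N})" using signal that by (simp add: switching_signal_def)
    from measurable_space[OF this that(2)] show ?thesis by simp
  qed
  have modes: "AE \<omega> in M. \<forall>j. mode_at \<sigma> \<tau> j \<omega> \<in> {1..N}"
    using paths AE_space
  proof eventually_elim
    case (elim \<omega>)
    \<comment> \<open>The range of the signal is known only at nonnegative times, so the switching
      instants must be shown nonnegative first.\<close>
    have "0 \<le> \<tau> j \<omega>" for j
      using lift_Suc_mono_le[of "\<lambda>j. \<tau> j \<omega>" 0 j] elim by (simp add: less_imp_le)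
    then show ?case using \<sigma>_range elim by (simp add: mode_at_def del: atLeastAtMost_iff)
  qed
  have start: "AE \<omega> in M. mode_at \<sigma> \<tau> 0 \<omega> = \<sigma>0"
    using paths AE_space by eventually_elim (simp add: mode_at_def \<sigma>_start)
  have "AE \<omega> in M. \<tau> 0 \<omega> = 0" using paths by eventually_elim simp
  from class_EH_unbounded[OF EH this \<tau>_meas]
  have unbounded: "AE \<omega> in M. \<forall>B. \<exists>k. \<tau> k \<omega> > B" .
  define W where "W k \<omega> = (\<Prod>j<k. ennreal (\<mu> * exp (- (lami (mode_at \<sigma> \<tau> j \<omega>) - c) * holding_time \<tau> (Suc j) \<omega>)))"
    for k \<omega>
  have W_meas: "W k \<in> borel_measurable M" for k
    using class_EH_measurable[OF EH] unfolding W_def by measurable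
  \<comment> \<open>The mean of the whole series of weights. It depends on \<open>\<sigma>0\<close>
    and \<open>c\<close> but not on \<open>x0\<close>, \<open>x\<close> or \<open>t\<close>, which
    makes the final bound uniform.\<close>
  define K where "K = 1 + \<mu> * lam / (lam + lami \<sigma>0 - c) /
      (1 - (\<Sum>i\<in>{1..N}. \<mu> * q i * lam / (lam + lami i - c)))"
  have W_int: "(\<integral>\<^sup>+\<omega>. (\<Sum>k. W k \<omega>) \<partial>M) = ennreal K"
    unfolding W_def K_def
    by (rule class_EH_nn_integral_weights[OF EH start modes \<sigma>0 _ c]) (use \<mu> in simp)
  have "K > 0"
    using \<mu> lam c(1)[OF \<sigma>0] c(2) by (auto simp: K_def intro!: add_pos_nonneg divide_nonneg_nonneg mult_nonneg_nonneg)
  show ?thesis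
  proof (rule gas_in_mean_if_exponential_bound[OF K\<alpha>2 \<open>c > 0\<close> \<open>K > 0\<close>])
    fix x0 x and t :: real assume sol: "switched_solution M f \<sigma> x0 x" and "t \<ge> 0"
    let ?b = "exp (- c * t) * \<alpha>2 (norm x0)"
    have b: "?b \<ge> 0" using class_K_nonneg[OF K\<alpha>2, of "norm x0"] by simp
    have sol_AE: "AE \<omega> in M. x 0 \<omega> = x0 \<and> (\<forall>T\<ge>0. abs_continuous_between 0 T (\<lambda>t. x t \<omega>)) \<and>
        (AE t in lborel. 0 \<le> t \<longrightarrow>
           ((\<lambda>s. x s \<omega>) has_vector_derivative f (\<sigma> t \<omega>) (x t \<omega>)) (at t within {0..}))"
      using sol by (simp add: switched_solution_def)
    have "(\<integral>\<^sup>+\<omega>. ennreal (\<alpha>1 (norm (x t \<omega>))) \<partial>M) \<le> (\<integral>\<^sup>+\<omega>. ennreal ?b * (\<Sum>k. W k \<omega>) \<partial>M)"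
    proof (rule nn_integral_mono_AE, use sol_AE paths modes unbounded AE_space in eventually_elim)
      case (elim \<omega>)
      define Z where "Z k = (\<Prod>j<k. \<mu> * exp (- (lami (mode_at \<sigma> \<tau> j \<omega>) - c) * (\<tau> (Suc j) \<omega> - \<tau> j \<omega>)))" for k
      have WZ: "W k \<omega> = ennreal (Z k)" and Z0: "Z k \<ge> 0" for k
        using \<mu> by (auto simp: W_def Z_def holding_time_def prod_ennreal intro!: prod_nonneg)
      from elim have \<tau>0: "\<tau> 0 \<omega> = 0" and \<tau>_inc: "\<And>k. \<tau> k \<omega> < \<tau> (Suc k) \<omega>"
        and const: "\<And>k t. \<tau> k \<omega> \<le> t \<Longrightarrow> t < \<tau> (Suc k) \<omega> \<Longrightarrow> \<sigma> t \<omega> = \<sigma> (\<tau> k \<omega>) \<omega>"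
        and modes_\<omega>: "\<And>k. \<sigma> (\<tau> k \<omega>) \<omega> \<in> {1..N}"
        and x0: "x 0 \<omega> = x0" and \<omega>: "\<omega> \<in> space M"
        and ac: "\<And>b. b \<ge> 0 \<Longrightarrow> abs_continuous_between 0 b (\<lambda>t. x t \<omega>)"
        and ode: "AE t in lborel. 0 \<le> t \<longrightarrow>
           ((\<lambda>s. x s \<omega>) has_vector_derivative f (\<sigma> t \<omega>) (x t \<omega>)) (at t within {0..})"
        and ex: "\<exists>k. t < \<tau> k \<omega>"
        unfolding mode_at_def by blast+
      \<comment> \<open>The first switching instant after \<open>t\<close> exists because the
        instants are unbounded. It is not \<open>\<tau> 0\<close>, which is zero, so its predecessor
        starts the holding interval containing \<open>t\<close>.\<close>
      define n where "n = (LEAST k. t < \<tau> k \<omega>)"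
      have n: "t < \<tau> n \<omega>"
        unfolding n_def by (rule LeastI_ex[OF ex])
      then obtain k where "n = Suc k" using \<tau>0 \<open>t \<ge> 0\<close> by (cases n) auto
      then have k: "\<tau> k \<omega> \<le> t" "t < \<tau> (Suc k) \<omega>"
        using n not_less_Least[of k "\<lambda>k. t < \<tau> k \<omega>"] by (simp_all add: n_def not_less)
      have "\<alpha>1 (norm (x t \<omega>)) \<le> V (\<sigma> t \<omega>) (x t \<omega>)"
        using V_bounds \<sigma>_range[OF \<open>t \<ge> 0\<close> \<omega>] by blast
      also have "\<dots> \<le> exp (- c * t) * V (\<sigma> 0 \<omega>) (x 0 \<omega>) * (Z k + Z (Suc k))"
        unfolding Z_def mode_at_def
        by (rule switched_lyapunov_path[OF \<tau>0 \<tau>_inc const modes_\<omega> ac ode f_cont V_grad V_nonneg V_decay _ V_jump k])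
          (use \<mu> in simp_all)
      also have "\<dots> \<le> ?b * (Z k + Z (Suc k))"
        using V_bounds[OF \<sigma>0, of x0] \<sigma>_start[OF \<omega>] x0 Z0
        by (intro mult_right_mono mult_left_mono) auto
      finally have "ennreal (\<alpha>1 (norm (x t \<omega>))) \<le> ennreal (?b * (Z k + Z (Suc k)))"
        by (rule ennreal_leI)
      \<comment> \<open>The index \<open>k\<close> varies with \<open>\<omega>\<close>; passing from
        these two terms to the whole series removes it before the expectation is taken.\<close>
      also have "\<dots> = ennreal ?b * (\<Sum>j\<in>{k, Suc k}. W j \<omega>)"
        using b Z0 by (simp add: WZ ennreal_mult' ennreal_plus)
      also have "\<dots> \<le> ennreal ?b * (\<Sum>j. W j \<omega>)"
        by (intro mult_left_mono sum_le_suminf) auto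
      finally show ?case .
    qed
    also have "\<dots> = ennreal ?b * ennreal K"
      using W_meas by (subst nn_integral_cmult) (auto simp: W_int)
    also have "\<dots> = ennreal (K * exp (- c * t) * \<alpha>2 (norm x0))"
      using b \<open>K > 0\<close> by (simp add: ennreal_mult[symmetric] mult_ac)
    finally show "(\<integral>\<^sup>+\<omega>. ennreal (\<alpha>1 (norm (x t \<omega>))) \<partial>M) \<le> ennreal (K * exp (- c * t) * \<alpha>2 (norm x0))" .
  qed
qed

end
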